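(* For every integer $t\geq 2$, the limit $\lim_{s\to\infty}\sqrt[s]{A_{321}(K_{s,t}^\alpha)}$ exists and \[4^{t-2}(3+2\sqrt 2)\leq\lim_{s\to\infty}\sqrt[s]{A_{321}(K_{s,t}^\alpha)}\leq\frac{(2t-1)^{2t-1}}{(t-1)^{t-1}t^t}.\]
   Context: $K^\alpha_{s,t}$ is the poset on $[st]$ whose order is generated by the covering relations $i\lessdot i+1$ for $1\le i\le s-1$ and $i\lessdot i+s$ for $1\le i\le st-s$ (the comb $K_{s,t}$ with elements $e_{i,j}$, covers $e_{i,1}\lessdot e_{i+1,1}$, $e_{i,j}\lessdot e_{i,j+1}$, and $e_{i,j}$ labeled $(j-1)s+i$). A linear extension is a permutation of $[st]$ in which $x$ precedes $y$ whenever $x<y$ in the poset. $A_{321}(P)$ is the number of linear extensions of $P$ avoiding the pattern $321$. *)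

theory Defs
  imports "HOL-Analysis.Analysis"
begin

definition Kcover :: "nat \<Rightarrow> nat \<Rightarrow> nat \<Rightarrow> nat \<Rightarrow> bool" where
  "Kcover s t i j \<longleftrightarrow>
     (1 \<le> i \<and> i \<le> s - 1 \<and> j = i + 1) \<or> (1 \<le> i \<and> i + s \<le> s * t \<and> j = i + s)"

definition Kleq :: "nat \<Rightarrow> nat \<Rightarrow> nat \<Rightarrow> nat \<Rightarrow> bool" where
  "Kleq s t = (Kcover s t)\<^sup>*\<^sup>*"

definition linext_K :: "nat \<Rightarrow> nat \<Rightarrow> nat list set" where
  "linext_K s t = {w. distinct w \<and> set w = {1..s * t} \<and>
     (\<forall>a b. a < length w \<and> b < length w \<and> w ! a \<noteq> w ! b \<and> Kleq s t (w ! a) (w ! b) \<longrightarrow> a < b)}"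

definition avoids321 :: "nat list \<Rightarrow> bool" where
  "avoids321 w \<longleftrightarrow> \<not> (\<exists>i j k. i < j \<and> j < k \<and> k < length w \<and> w ! i > w ! j \<and> w ! j > w ! k)"

definition A321_K :: "nat \<Rightarrow> nat \<Rightarrow> nat" where
  "A321_K s t = card {w \<in> linext_K s t. avoids321 w}"

end

theory Submission
  imports Defs "HOL-Combinatorics.Permutations" "HOL-Real_Asymp.Real_Asymp"
begin

text \<open>
  A 321-avoiding permutation is determined by the values that have a smaller value behind them and by
  the positions of these values. This encodes the linear extensions of the comb as sequences of
  \<open>s * t\<close> natural numbers whose partial sums lie between two barriers: an upper one that makes the
  sequence a Lukasiewicz word, and a lower one that comes from the teeth of the comb.

  Keeping only the bound \<open>s * t\<close> on the sum leaves \<open>binom ((2 * t - 1) * s, t * s)\<close> sequences,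
  hence the upper bound.
  The lower barrier may be violated by \<open>o(s)\<close> without affecting the growth rate, because \<open>D\<close>
  additional columns pay for violations of size less than \<open>D\<close>. This has two consequences.
  First, the limit exists: by the pigeonhole principle there is a class of codes that is smaller than
  the set of all codes by a subexponential factor only and in which all prefix counts agree up to
  \<open>O(sqrt s)\<close>; any \<open>k\<close> codes of this class can be interleaved into a code for \<open>k * s\<close>, so the count is supermultiplicative up to subexponential factors.
  Second, prescribing only the sums of all blocks of a fixed length \<open>m\<close> gives the lower bound
  \<open>27 / 4 * 4 ^ (t - 2)\<close> in the limit \<open>m \<rightarrow> \<infinity>\<close>, which is more than needed.
\<close>

section \<open>Linear extensions as permutations\<close>

text \<open>The inverse of the linear extension: \<open>\<pi> v\<close> is the position, counted
  from 0, of the label \<open>v + 1\<close>. The pattern 321 is its own inverse, so avoidance keeps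
  its form; the order is imposed on covering pairs only and propagates along
  \<open>Kleq\<close>.\<close>

definition comb_perms :: "nat \<Rightarrow> nat \<Rightarrow> (nat \<Rightarrow> nat) set" where
  "comb_perms s t = {\<pi>. \<pi> permutes {..<s * t} \<and>
     (\<forall>v. Suc v < s \<longrightarrow> \<pi> v < \<pi> (Suc v)) \<and>
     (\<forall>v. v + s < s * t \<longrightarrow> \<pi> v < \<pi> (v + s)) \<and>
     (\<forall>x y z. x < y \<and> y < z \<and> z < s * t \<longrightarrow> \<not> (\<pi> z < \<pi> y \<and> \<pi> y < \<pi> x))}"

definition word_of_perm :: "nat \<Rightarrow> (nat \<Rightarrow> nat) \<Rightarrow> nat list" where
  "word_of_perm n \<pi> = map (\<lambda>q. Suc (inv \<pi> q)) [0..<n]"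

lemma length_word_of_perm [simp]: "length (word_of_perm n \<pi>) = n"
  by (simp add: word_of_perm_def)

lemma nth_word_of_perm [simp]: "q < n \<Longrightarrow> word_of_perm n \<pi> ! q = Suc (inv \<pi> q)"
  by (simp add: word_of_perm_def)

text \<open>The last fact is the working form of avoidance: a value with a smaller value behind it
  comes before every larger value.\<close>

lemma comb_permsD:
  assumes "\<pi> \<in> comb_perms s t"
  shows "\<pi> permutes {..<s * t}"
    and "Suc v < s \<Longrightarrow> \<pi> v < \<pi> (Suc v)"
    and "v + s < s * t \<Longrightarrow> \<pi> v < \<pi> (v + s)"
    and "x < y \<Longrightarrow> y < z \<Longrightarrow> z < s * t \<Longrightarrow> \<pi> y < \<pi> x \<Longrightarrow> \<pi> y < \<pi> z"
proof -
  show "\<pi> y < \<pi> z" if "x < y" "y < z" "z < s * t" "\<pi> y < \<pi> x"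
  proof -
    have "\<not> \<pi> z < \<pi> y" using that assms unfolding comb_perms_def by blast
    moreover have "inj \<pi>" using assms by (auto simp: comb_perms_def intro: permutes_inj)
    ultimately show ?thesis using that(2) by (metis injD nat_neq_iff)
  qed
qed (use assms in \<open>auto simp: comb_perms_def\<close>)

lemma Kleq_imp_le:
  assumes "\<pi> \<in> comb_perms s t" "1 \<le> t" "Kleq s t a b" "1 \<le> a" "a \<le> s * t"
  shows "1 \<le> b \<and> b \<le> s * t \<and> \<pi> (a - 1) \<le> \<pi> (b - 1)"
  using assms(3)[unfolded Kleq_def]
proof (induction rule: rtranclp_induct)
  case base
  then show ?case using assms by simp
next
  case (step y z)
  from step(2) consider "y \<le> s - 1" "z = y + 1" | "y + s \<le> s * t" "z = y + s"
    unfolding Kcover_def by blast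
  then show ?case
  proof cases
    case 1
    have "s \<le> s * t" using assms(2) by simp
    moreover have *: "Suc (y - 1) < s" "Suc (y - 1) = z - 1" using 1 step.IH by linarith+
    ultimately have "z \<le> s * t" using 1 by linarith
    moreover have "\<pi> (y - 1) < \<pi> (z - 1)"
      using comb_permsD(2)[OF assms(1) *(1)] *(2) by simp
    ultimately show ?thesis using 1 step.IH by simp
  next
    case 2
    have "y - 1 + s = z - 1" "y - 1 + s < s * t" using 2 step.IH by auto
    then have "\<pi> (y - 1) < \<pi> (z - 1)"
      using comb_permsD(3)[OF assms(1), of "y - 1"] by simp
    then show ?thesis using 2 step.IH by simp
  qed
qed

lemma bij_betw_word_of_perm:
  assumes "1 \<le> t"
  shows "bij_betw (word_of_perm (s * t)) (comb_perms s t) {w \<in> linext_K s t. avoids321 w}"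
proof (rule bij_betw_imageI)
  define n where "n = s * t"
  show "inj_on (word_of_perm (s * t)) (comb_perms s t)"
  proof (rule inj_onI)
    fix \<pi> \<rho> assume p: "\<pi> \<in> comb_perms s t" "\<rho> \<in> comb_perms s t"
      and eq: "word_of_perm (s * t) \<pi> = word_of_perm (s * t) \<rho>"
    have perm: "\<pi> permutes {..<n}" "\<rho> permutes {..<n}"
      using p by (auto simp: comb_perms_def n_def)
    have "inv \<pi> q = inv \<rho> q" for q
    proof (cases "q < n")
      case True
      then show ?thesis using eq by (metis n_def nth_word_of_perm Suc_inject)
    next
      case False
      then show ?thesis using perm
        by (metis lessThan_iff permutes_inv permutes_not_in)
    qed
    then have "inv \<pi> = inv \<rho>" by blast
    then show "\<pi> = \<rho>" using perm by (metis permutes_inv_inv)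
  qed
  show "word_of_perm (s * t) ` comb_perms s t = {w \<in> linext_K s t. avoids321 w}"
  proof (intro equalityI subsetI)
    fix w assume "w \<in> word_of_perm (s * t) ` comb_perms s t"
    then obtain \<pi> where pc: "\<pi> \<in> comb_perms s t" and w: "w = word_of_perm n \<pi>"
      by (auto simp: n_def)
    have perm: "\<pi> permutes {..<n}" using pc by (auto simp: comb_perms_def n_def)
    have iperm: "inv \<pi> permutes {..<n}" using perm by (rule permutes_inv)
    have pinv: "\<pi> (inv \<pi> q) = q" for q using perm by (rule permutes_inverses(1))
    have lt: "inv \<pi> q < n" if "q < n" for q
      using that iperm by (metis lessThan_iff permutes_in_image)
    have "distinct w" unfolding w word_of_perm_def
      using permutes_inj[OF iperm] by (auto simp: distinct_map inj_on_def)
    moreover have "set w = {1..s * t}"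
    proof -
      have "set w = Suc ` inv \<pi> ` {..<n}"
        by (auto simp: w word_of_perm_def lessThan_atLeast0 image_image)
      also have "\<dots> = Suc ` {..<n}" using iperm by (simp add: permutes_image)
      also have "\<dots> = {1..n}" by (auto simp: image_Suc_lessThan)
      finally show ?thesis by (simp add: n_def)
    qed
    moreover have "a < b" if "a < length w" "b < length w" "w ! a \<noteq> w ! b" "Kleq s t (w ! a) (w ! b)" for a b
    proof -
      have ab: "a < n" "b < n" using that by (auto simp: w)
      have "\<pi> (w ! a - 1) \<le> \<pi> (w ! b - 1)"
        using Kleq_imp_le[OF pc assms that(4)] ab lt[of a] by (auto simp: w n_def Suc_leI)
      then have "a \<le> b" using ab by (simp add: w pinv)
      then show ?thesis using that(3) by (cases "a = b") auto
    qed
    moreover have "avoids321 w"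
      unfolding avoids321_def
    proof (intro notI, elim exE conjE)
      fix i j k assume ijk: "i < j" "j < k" "k < length w" "w ! i > w ! j" "w ! j > w ! k"
      then have "i < n" "j < n" "k < n" by (auto simp: w)
      with ijk have "inv \<pi> k < inv \<pi> j" "inv \<pi> j < inv \<pi> i" "inv \<pi> i < n"
        using lt by (auto simp: w)
      moreover have "\<pi> (inv \<pi> i) < \<pi> (inv \<pi> j)" "\<pi> (inv \<pi> j) < \<pi> (inv \<pi> k)"
        using ijk by (auto simp: pinv)
      ultimately show False using pc unfolding comb_perms_def n_def by blast
    qed
    ultimately show "w \<in> {w \<in> linext_K s t. avoids321 w}" by (auto simp: linext_K_def)
  next
    fix w assume "w \<in> {w \<in> linext_K s t. avoids321 w}"
    then have dw: "distinct w" and sw: "set w = {1..n}"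
      and ord: "\<And>a b. a < length w \<Longrightarrow> b < length w \<Longrightarrow> w ! a \<noteq> w ! b \<Longrightarrow> Kleq s t (w ! a) (w ! b) \<Longrightarrow> a < b"
      and av: "avoids321 w" by (auto simp: linext_K_def n_def)
    have lw: "length w = n" using dw sw distinct_card by fastforce
    \<comment> \<open>The word shifted to start at 0 and continued by the identity, as
      \<open>permutes\<close> demands; its inverse is the required \<open>\<pi>\<close>.\<close>
    define \<sigma> where "\<sigma> q = (if q < n then w ! q - 1 else q)" for q
    have wq: "w ! q \<in> {1..n}" if "q < n" for q using that lw sw by (metis nth_mem)
    have "bij_betw \<sigma> {..<n} {..<n}"
    proof (rule bij_betw_imageI)
      show inj: "inj_on \<sigma> {..<n}"
      proof (rule inj_onI)
        fix x y assume "x \<in> {..<n}" "y \<in> {..<n}" "\<sigma> x = \<sigma> y"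
        then have "w ! x = w ! y" using wq[of x] wq[of y] by (auto simp: \<sigma>_def)
        then show "x = y" using dw lw \<open>x \<in> {..<n}\<close> \<open>y \<in> {..<n}\<close>
          by (simp add: nth_eq_iff_index_eq)
      qed
      have "\<sigma> ` {..<n} \<subseteq> {..<n}" using wq by (fastforce simp: \<sigma>_def)
      then show "\<sigma> ` {..<n} = {..<n}" using inj
        by (simp add: endo_inj_surj)
    qed
    then have sp: "\<sigma> permutes {..<n}" by (rule bij_imp_permutes) (simp add: \<sigma>_def)
    define \<pi> where "\<pi> = inv \<sigma>"
    have pp: "\<pi> permutes {..<n}" unfolding \<pi>_def using sp by (rule permutes_inv)
    have ipi: "inv \<pi> = \<sigma>" unfolding \<pi>_def using sp by (rule permutes_inv_inv)
    have sig: "\<sigma> (\<pi> v) = v" for v unfolding \<pi>_def using sp by (rule permutes_inverses(1))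
    have plt: "\<pi> v < n" if "v < n" for v using that pp by (metis lessThan_iff permutes_in_image)
    have wpi: "w ! \<pi> v = Suc v" if "v < n" for v
      using sig[of v] plt[OF that] wq[OF plt[OF that]] by (auto simp: \<sigma>_def)
    have less: "\<pi> u < \<pi> v" if "u < n" "v < n" "Kcover s t (Suc u) (Suc v)" "u \<noteq> v" for u v
      using ord[of "\<pi> u" "\<pi> v"] that plt wpi lw by (simp add: Kleq_def r_into_rtranclp)
    have "\<pi> \<in> comb_perms s t" unfolding comb_perms_def
    proof (intro CollectI conjI allI impI)
      show "\<pi> permutes {..<s * t}" using pp n_def by simp
    next
      fix v assume "Suc v < s"
      moreover have "s \<le> n" using assms by (simp add: n_def)
      ultimately show "\<pi> v < \<pi> (Suc v)" by (intro less) (auto simp: Kcover_def)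
    next
      fix v assume "v + s < s * t"
      moreover from this have "s \<noteq> 0" by (metis add_is_0 mult_0 not_less_zero)
      ultimately show "\<pi> v < \<pi> (v + s)" by (intro less) (auto simp: Kcover_def n_def)
    next
      fix x y z assume xyz: "x < y \<and> y < z \<and> z < s * t"
      show "\<not> (\<pi> z < \<pi> y \<and> \<pi> y < \<pi> x)"
      proof
        assume "\<pi> z < \<pi> y \<and> \<pi> y < \<pi> x"
        moreover have "w ! \<pi> x = Suc x" "w ! \<pi> y = Suc y" "w ! \<pi> z = Suc z"
          using xyz by (auto intro!: wpi simp: n_def)
        moreover have "\<pi> x < length w" using xyz plt lw n_def by simp
        ultimately show False using av xyz unfolding avoids321_def by fastforce
      qed
    qed
    moreover have "w = word_of_perm (s * t) \<pi>"
      using lw wq by (auto intro!: nth_equalityI simp: ipi \<sigma>_def n_def[symmetric]) (metis Suc_pred' atLeastAtMost_iff less_eq_Suc_le One_nat_def)?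
    ultimately show "w \<in> word_of_perm (s * t) ` comb_perms s t" by blast
  qed
qed

lemma A321_K_eq_card_comb_perms:
  assumes "1 \<le> t"
  shows "A321_K s t = card (comb_perms s t)"
  unfolding A321_K_def using bij_betw_same_card[OF bij_betw_word_of_perm[OF assms]] by simp

section \<open>Codes of 321-avoiding permutations\<close>

abbreviation psum :: "(nat \<Rightarrow> nat) \<Rightarrow> nat \<Rightarrow> nat" where
  "psum c p \<equiv> sum c {..<p}"

definition psupp :: "(nat \<Rightarrow> nat) \<Rightarrow> nat \<Rightarrow> nat" where
  "psupp c p = (\<Sum>q<p. of_bool (0 < c q))"

lemma psupp_0 [simp]: "psupp c 0 = 0"
  and psupp_Suc [simp]: "psupp c (Suc p) = psupp c p + of_bool (0 < c p)"
  by (simp_all add: psupp_def)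

lemma psum_mono: "p \<le> q \<Longrightarrow> psum c p \<le> psum c q"
  by (rule sum_mono2) auto

lemma psupp_mono: "p \<le> q \<Longrightarrow> psupp c p \<le> psupp c q"
  unfolding psupp_def by (rule sum_mono2) auto

lemma psupp_le_add: "psupp c (p + d) \<le> psupp c p + d"
  by (induction d) (auto simp: of_bool_def)

lemma psupp_le_psum: "psupp c p \<le> psum c p"
  unfolding psupp_def by (rule sum_mono) (auto simp: of_bool_def)

lemma psupp_eq_card: "psupp c p = card {q. q < p \<and> 0 < c q}"
proof (induction p)
  case (Suc p)
  have "{q. q < Suc p \<and> 0 < c q} = (if 0 < c p then insert p {q. q < p \<and> 0 < c q} else {q. q < p \<and> 0 < c q})"
    by (auto simp: less_Suc_eq)
  then show ?case using Suc by simp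
qed simp

text \<open>In terms of the permutation \<open>\<pi>\<close> encoded below, the last condition says for \<open>e = 0\<close> that the
  value \<open>p\<close> comes behind \<open>p - s\<close> if exactly \<open>p\<close> has a smaller value behind it; in all other cases this
  is automatic. The number \<open>e\<close> is the permitted violation.\<close>

definition codes :: "nat \<Rightarrow> nat \<Rightarrow> nat \<Rightarrow> (nat \<Rightarrow> nat) set" where
  "codes e s t = {c. (\<forall>p. p < s \<or> s * t \<le> p \<longrightarrow> c p = 0) \<and>
     (\<forall>p < s * t. psum c (Suc p) \<le> p) \<and>
     (\<forall>p \<ge> s. 0 < c p \<and> c (p - s) = 0 \<longrightarrow>
        Suc p + psupp c (Suc p) \<le> psum c (Suc p) + s + psupp c (Suc (p - s)) + e)}"

lemma codesD:
  assumes "c \<in> codes e s t"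
  shows "p < s \<Longrightarrow> c p = 0" and "s * t \<le> p \<Longrightarrow> c p = 0"
    and "p < s * t \<Longrightarrow> psum c (Suc p) \<le> p"
    and "s \<le> p \<Longrightarrow> 0 < c p \<Longrightarrow> c (p - s) = 0 \<Longrightarrow>
        Suc p + psupp c (Suc p) \<le> psum c (Suc p) + s + psupp c (Suc (p - s)) + e"
  using assms unfolding codes_def by blast+

lemma codes_psum_zero:
  assumes "c \<in> codes e s t"
  shows "psum c s = 0" and "psupp c s = 0"
  using codesD(1)[OF assms] by (auto simp: psupp_def)

lemma codes_psum_le:
  assumes "c \<in> codes e s t"
  shows "psum c p \<le> s * t"
proof (cases "s * t = 0 \<or> p = 0")
  case True
  then show ?thesis using codesD(2)[OF assms] by auto
next
  case False
  show ?thesis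
  proof (cases "p \<le> s * t")
    case True
    then show ?thesis using codesD(3)[OF assms, of "p - 1"] False by fastforce
  next
    case *: False
    have "psum c p = psum c (s * t)"
      using * codesD(2)[OF assms] by (intro sum.mono_neutral_right) auto
    moreover have "Suc (s * t - 1) = s * t" "s * t - 1 < s * t" using False by auto
    ultimately show ?thesis using codesD(3)[OF assms, of "s * t - 1"] by simp
  qed
qed

lemma finite_codes: "finite (codes e s t)"
proof (rule finite_subset)
  show "codes e s t \<subseteq> {c. \<forall>p. (p \<in> {..<s * t} \<longrightarrow> c p \<in> {..s * t}) \<and> (p \<notin> {..<s * t} \<longrightarrow> c p = 0)}"
  proof (intro subsetI CollectI allI conjI impI)
    fix c p assume c: "c \<in> codes e s t"
    have "c p \<le> psum c (Suc p)" by simp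
    then show "c p \<in> {..s * t}" using codes_psum_le[OF c, of "Suc p"] by simp
    show "c p = 0" if "p \<notin> {..<s * t}" using that codesD(2)[OF c] by simp
  qed
  show "finite \<dots>" by (rule finite_set_of_finite_funs) auto
qed

text \<open>Here \<open>\<pi>\<close> sends a value to its position. In a 321-avoiding permutation the overtaken values
  occupy increasing positions; counted from 1, these are the partial sums of the code at its nonzero
  entries.\<close>

definition overtaken :: "(nat \<Rightarrow> nat) \<Rightarrow> nat \<Rightarrow> bool" where
  "overtaken \<pi> v \<longleftrightarrow> (\<exists>u<v. \<pi> v < \<pi> u)"

text \<open>Position of the last overtaken value below the argument, or 0 if there is none. Counting
  positions from 1 keeps the first increment positive even if that position is the very first
  one.\<close>

primrec top_pos :: "(nat \<Rightarrow> nat) \<Rightarrow> nat \<Rightarrow> nat" where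
  "top_pos \<pi> 0 = 0"
| "top_pos \<pi> (Suc v) = (if overtaken \<pi> v then Suc (\<pi> v) else top_pos \<pi> v)"

definition code_of :: "(nat \<Rightarrow> nat) \<Rightarrow> nat \<Rightarrow> nat" where
  "code_of \<pi> v = top_pos \<pi> (Suc v) - top_pos \<pi> v"

lemma not_overtakenD: "\<not> overtaken \<pi> v \<Longrightarrow> u < v \<Longrightarrow> \<pi> u \<le> \<pi> v"
  unfolding overtaken_def by (meson not_le)

lemma top_pos_cases: "top_pos \<pi> p = 0 \<or> (\<exists>u<p. overtaken \<pi> u \<and> top_pos \<pi> p = Suc (\<pi> u))"
  by (induction p) (auto simp: less_Suc_eq)

lemma overtaken_mono:
  assumes "\<pi> \<in> comb_perms s t" "overtaken \<pi> u" "u < v" "v < s * t"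
  shows "\<pi> u < \<pi> v"
  using assms comb_permsD(4)[OF assms(1)] unfolding overtaken_def by blast

lemma overtaken_less:
  assumes "\<pi> \<in> comb_perms s t" "overtaken \<pi> v"
  shows "v < s * t"
proof (rule ccontr)
  note perm = comb_permsD(1)[OF assms(1)]
  assume *: "\<not> v < s * t"
  then have "\<pi> v = v" using perm by (simp add: permutes_not_in)
  moreover have "\<pi> u < v" if "u < v" for u
    using that * perm permutes_in_image[OF perm, of u]
    by (cases "u < s * t") (auto simp: permutes_not_in)
  ultimately show False using assms(2) by (metis overtaken_def less_asym)
qed

lemma top_pos_step:
  assumes "\<pi> \<in> comb_perms s t"
  shows "top_pos \<pi> v \<le> top_pos \<pi> (Suc v)" and "overtaken \<pi> v \<Longrightarrow> top_pos \<pi> v < top_pos \<pi> (Suc v)"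
proof -
  show *: "top_pos \<pi> v < top_pos \<pi> (Suc v)" if "overtaken \<pi> v"
    using top_pos_cases[of \<pi> v] that overtaken_mono[OF assms] overtaken_less[OF assms] by auto
  show "top_pos \<pi> v \<le> top_pos \<pi> (Suc v)" using * by (cases "overtaken \<pi> v") auto
qed

text \<open>\<open>top_pos\<close> is monotone, so the truncated differences in
  \<open>code_of\<close> are true differences and telescope.\<close>

lemma psum_code_of:
  assumes "\<pi> \<in> comb_perms s t"
  shows "psum (code_of \<pi>) p = top_pos \<pi> p"
proof (induction p)
  case (Suc p)
  have "psum (code_of \<pi>) (Suc p) = top_pos \<pi> p + code_of \<pi> p"
    using Suc by simp
  also have "\<dots> = top_pos \<pi> (Suc p)"
    unfolding code_of_def using top_pos_step(1)[OF assms, of p] by linarith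
  finally show ?case .
qed simp

lemma code_of_pos_iff:
  assumes "\<pi> \<in> comb_perms s t"
  shows "0 < code_of \<pi> v \<longleftrightarrow> overtaken \<pi> v"
  using top_pos_step(2)[OF assms, of v] by (auto simp: code_of_def)

text \<open>A position is the number of values placed before it; this turns bounds on positions into
  counting.\<close>

lemma card_below_perm:
  fixes v n :: nat
  assumes "v < n" and perm: "\<pi> permutes {..<n}"
  shows "card {u. u < n \<and> \<pi> u < \<pi> v} = \<pi> v"
proof -
  have "\<pi> v < n" using assms(1) perm by (metis lessThan_iff permutes_in_image)
  have "\<pi> ` {u. u < n \<and> \<pi> u < \<pi> v} = {..<\<pi> v}"
  proof (intro equalityI subsetI)
    fix q assume "q \<in> {..<\<pi> v}"
    then have "q < n" using \<open>\<pi> v < n\<close> by simp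
    then have "q \<in> \<pi> ` {..<n}" using perm by (simp add: permutes_image)
    then show "q \<in> \<pi> ` {u. u < n \<and> \<pi> u < \<pi> v}" using \<open>q \<in> {..<\<pi> v}\<close> by auto
  qed auto
  then have "card {..<\<pi> v} = card {u. u < n \<and> \<pi> u < \<pi> v}"
    using perm by (metis card_image inj_on_subset permutes_inj subset_UNIV)
  then show ?thesis by simp
qed

lemma code_of_in_codes:
  assumes c: "\<pi> \<in> comb_perms s t"
  shows "code_of \<pi> \<in> codes 0 s t"
  unfolding codes_def
proof (intro CollectI conjI allI impI)
  define n where "n = s * t"
  note perm = comb_permsD(1)[OF c, folded n_def]
  have inj: "\<pi> u = \<pi> v \<longleftrightarrow> u = v" for u v using permutes_inj[OF perm] by (auto dest: injD)
  have row1: "\<pi> u < \<pi> v" if "u < v" "v < s" for u v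
    using that(1,2)
  proof (induction rule: strict_inc_induct)
    case (base i)
    then show ?case using comb_permsD(2)[OF c] by simp
  next
    case (step i)
    then show ?case using comb_permsD(2)[OF c, of i] by simp
  qed
  fix p
  show "code_of \<pi> p = 0" if "p < s \<or> s * t \<le> p"
  proof -
    have "\<not> overtaken \<pi> p" using that row1 overtaken_less[OF c]
      by (metis leD less_asym overtaken_def)
    then show ?thesis using code_of_pos_iff[OF c] by blast
  qed
  show "psum (code_of \<pi>) (Suc p) \<le> p" if "p < s * t"
  proof -
    have "top_pos \<pi> (Suc p) \<le> p"
    proof (cases "top_pos \<pi> (Suc p) = 0")
      case False
      then obtain u where u: "u < Suc p" "overtaken \<pi> u" "top_pos \<pi> (Suc p) = Suc (\<pi> u)"
        using top_pos_cases[of \<pi> "Suc p"] by auto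
      have un: "u < n" using u overtaken_less[OF c] n_def by simp
      obtain w where w: "w < u" "\<pi> u < \<pi> w" using u(2) by (auto simp: overtaken_def)
      \<comment> \<open>Only values below \<open>u\<close> are placed before an overtaken
        \<open>u\<close>, and the smaller value \<open>w\<close> is not among them; hence
        \<open>\<pi> u < u\<close>.\<close>
      have "{x. x < n \<and> \<pi> x < \<pi> u} \<subseteq> {..<u} - {w}"
      proof
        fix x assume x: "x \<in> {x. x < n \<and> \<pi> x < \<pi> u}"
        then have "x < u" using overtaken_mono[OF c u(2), of x] n_def by (cases x u rule: linorder_cases) auto
        then show "x \<in> {..<u} - {w}" using x w by auto
      qed
      then have "card {x. x < n \<and> \<pi> x < \<pi> u} \<le> card ({..<u} - {w})" by (intro card_mono) auto
      then show ?thesis using card_below_perm[OF un perm] w u by simp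
    qed simp
    then show ?thesis by (simp only: psum_code_of[OF c])
  qed
  show "Suc p + psupp (code_of \<pi>) (Suc p) \<le> psum (code_of \<pi>) (Suc p) + s + psupp (code_of \<pi>) (Suc (p - s)) + 0"
    if "s \<le> p" "0 < code_of \<pi> p \<and> code_of \<pi> (p - s) = 0"
  proof -
    have ov: "overtaken \<pi> p" "\<not> overtaken \<pi> (p - s)"
      using that code_of_pos_iff[OF c, of p] code_of_pos_iff[OF c, of "p - s"] by simp_all
    have pn: "p < n" using overtaken_less[OF c ov(1)] n_def by simp
    have s0: "0 < s" using pn n_def by (cases s) auto
    \<comment> \<open>Both sets are placed before \<open>p\<close>: overtaken values as well as the
      others have increasing positions, and \<open>p - s\<close> precedes \<open>p\<close>. Counting
      the two sets gives the lower barrier.\<close>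
    let ?A = "{u. u < p \<and> overtaken \<pi> u}"
    let ?B = "{u. u < Suc (p - s) \<and> \<not> overtaken \<pi> u}"
    have less: "\<pi> (p - s) < \<pi> p" using comb_permsD(3)[OF c, of "p - s"] that pn n_def by simp
    have "?A \<union> ?B \<subseteq> {u. u < n \<and> \<pi> u < \<pi> p}"
    proof
      fix u assume "u \<in> ?A \<union> ?B"
      then consider "u \<in> ?A" | "u < p - s" "\<not> overtaken \<pi> u" | "u = p - s" by fastforce
      then show "u \<in> {u. u < n \<and> \<pi> u < \<pi> p}"
      proof cases
        case 1
        then show ?thesis using overtaken_mono[OF c, of u p] pn n_def by auto
      next
        case 2
        then show ?thesis using not_overtakenD[OF ov(2)] less pn by fastforce
      next
        case 3
        then show ?thesis using less pn by simp
      qed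
    qed
    then have "card (?A \<union> ?B) \<le> card {u. u < n \<and> \<pi> u < \<pi> p}" by (intro card_mono) auto
    also have "\<dots> = \<pi> p" by (rule card_below_perm[OF pn perm])
    finally have "card ?A + card ?B \<le> \<pi> p" by (subst (asm) card_Un_disjoint) auto
    moreover have "card ?A = psupp (code_of \<pi>) p"
      by (simp add: psupp_eq_card code_of_pos_iff[OF c])
    moreover have "card ?B + psupp (code_of \<pi>) (Suc (p - s)) = Suc (p - s)"
    proof -
      have "card ?B + card {u. u < Suc (p - s) \<and> overtaken \<pi> u} = card (?B \<union> {u. u < Suc (p - s) \<and> overtaken \<pi> u})"
        by (intro card_Un_disjoint[symmetric]) auto
      also have "?B \<union> {u. u < Suc (p - s) \<and> overtaken \<pi> u} = {..<Suc (p - s)}" by auto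
      finally show ?thesis by (simp add: psupp_eq_card code_of_pos_iff[OF c] del: psupp_Suc)
    qed
    moreover have "psum (code_of \<pi>) (Suc p) = Suc (\<pi> p)"
      using ov(1) by (simp only: psum_code_of[OF c] top_pos.simps if_True)
    ultimately show ?thesis using that s0 by simp
  qed
qed

text \<open>The code fixes the positions of the overtaken values; the others fill the remaining
  positions in increasing order, each taking the least free one.\<close>

lemma inj_on_code_of: "inj_on code_of (comb_perms s t)"
proof (rule inj_onI)
  fix \<pi> \<rho> assume c: "\<pi> \<in> comb_perms s t" "\<rho> \<in> comb_perms s t" and eq: "code_of \<pi> = code_of \<rho>"
  define n where "n = s * t"
  note perm = comb_permsD(1)[OF c(1), folded n_def] comb_permsD(1)[OF c(2), folded n_def]
  have ov: "overtaken \<pi> v \<longleftrightarrow> overtaken \<rho> v" for v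
    by (metis eq code_of_pos_iff c)
  have top: "top_pos \<pi> v = top_pos \<rho> v" for v
    by (metis eq psum_code_of c)
  have blue: "\<pi> v = \<rho> v" if "overtaken \<pi> v" for v
    using that top[of "Suc v"] ov[of v] by simp
  have red: "\<sigma> v = (LEAST q. q \<notin> \<sigma> ` {u. overtaken \<sigma> u \<or> u < v})"
    if "\<sigma> permutes {..<n}" "\<not> overtaken \<sigma> v" for \<sigma> v
  proof (rule Least_equality[symmetric])
    show "\<sigma> v \<notin> \<sigma> ` {u. overtaken \<sigma> u \<or> u < v}"
      using that permutes_inj[OF that(1)] by (auto dest: injD)
    have "surj \<sigma>" using that(1) by (rule permutes_surj)
    fix q assume q: "q \<notin> \<sigma> ` {u. overtaken \<sigma> u \<or> u < v}"
    obtain u where u: "q = \<sigma> u" using \<open>surj \<sigma>\<close> by (metis surjD)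
    have "\<not> overtaken \<sigma> u" "\<not> u < v" using q u by auto
    then show "\<sigma> v \<le> q" using u not_overtakenD[of \<sigma> u v] by (cases "u = v") auto
  qed
  have "\<pi> v = \<rho> v" for v
  proof (induction v rule: less_induct)
    case (less v)
    show ?case
    proof (cases "overtaken \<pi> v")
      case False
      have "\<pi> ` {u. overtaken \<pi> u \<or> u < v} = \<rho> ` {u. overtaken \<rho> u \<or> u < v}"
        using less blue ov by (intro image_cong) auto
      then show ?thesis using red[OF perm(1) False] red[OF perm(2)] False ov by simp
    qed (rule blue)
  qed
  then show "\<pi> = \<rho>" by blast
qed


text \<open>Values with nonzero entry (\<open>B\<close>) go to the positions dictated by the prefix
  sums, the others (\<open>R\<close>) to the free positions in increasing order. The upper barrier
  makes \<open>B\<close> exactly the set of overtaken values, and the lower barrier settles the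
  remaining tooth covers.\<close>

lemma comb_perm_of_code:
  assumes c: "c \<in> codes 0 s t" and s: "1 \<le> s" and t: "1 \<le> t"
  shows "\<exists>\<pi> \<in> comb_perms s t. code_of \<pi> = c"
proof -
  define n where "n = s * t"
  define B where "B = {v. v < n \<and> 0 < c v}"
  define R where "R = {v. v < n \<and> c v = 0}"
  define \<rho> where "\<rho> v = psum c (Suc v) - 1" for v
  have Suc_rho: "Suc (\<rho> v) = psum c (Suc v)" if "v \<in> B" for v
    using that by (simp add: \<rho>_def B_def)
  have rho_less: "\<rho> v < v" if "v \<in> B" for v
    using Suc_rho[OF that] codesD(3)[OF c, of v] that by (simp add: B_def n_def)
  have rho_mono: "\<rho> u < \<rho> v" if "u < v" "u \<in> B" "v \<in> B" for u v
  proof -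
    have "psum c (Suc u) \<le> psum c v" using that by (intro psum_mono) auto
    moreover have "psum c v < psum c (Suc v)" using that by (simp add: B_def)
    ultimately show ?thesis using Suc_rho[OF that(2)] Suc_rho[OF that(3)] by linarith
  qed
  have rho_inj: "inj_on \<rho> B"
    by (rule linorder_inj_onI') (use rho_mono in force)
  have BR: "B \<union> R = {..<n}" "B \<inter> R = {}" "finite B" "finite R" by (auto simp: B_def R_def)
  define Q where "Q = {..<n} - \<rho> ` B"
  have rho_sub: "\<rho> ` B \<subseteq> {..<n}" using rho_less by (fastforce simp: B_def)
  have finQ: "finite Q" by (simp add: Q_def)
  have "card Q = n - card B" using rho_sub BR
    by (simp add: Q_def card_Diff_subset card_image[OF rho_inj])
  moreover have "card R = n - card B"
  proof -
    have "card B + card R = n" using BR by (metis card_Un_disjoint card_lessThan)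
    then show ?thesis by simp
  qed
  ultimately have cardRQ: "card R = card Q" by simp
  obtain hR where hR: "bij_betw hR {..<card R} R" "strict_mono_on {..<card R} hR"
    using ex_bij_betw_strict_mono_card[OF BR(4)] by blast
  obtain hQ where hQ: "bij_betw hQ {..<card R} Q" "strict_mono_on {..<card R} hQ"
    using ex_bij_betw_strict_mono_card[OF finQ] cardRQ by metis
  \<comment> \<open>The order isomorphism from \<open>R\<close> to the free positions, by way of the
    two increasing enumerations.\<close>
  define g where "g = hQ \<circ> the_inv_into {..<card R} hR"
  have g_bij: "bij_betw g R Q" unfolding g_def
    using bij_betw_the_inv_into[OF hR(1)] hQ(1) by (rule bij_betw_trans)
  have g_mono: "g u < g v" if "u < v" "u \<in> R" "v \<in> R" for u v
  proof -
    have "u \<in> hR ` {..<card R}" "v \<in> hR ` {..<card R}"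
      using that hR(1) by (simp_all add: bij_betw_def)
    then obtain i j where ij: "i < card R" "j < card R" "u = hR i" "v = hR j" by fastforce
    have "i < j"
      using strict_mono_on_less[OF hR(2), of i j] that(1) ij by simp
    moreover have "g u = hQ i" "g v = hQ j"
      using ij hR(1) by (auto simp: g_def the_inv_into_f_f bij_betw_def)
    ultimately show ?thesis using hQ(2) ij by (simp add: strict_mono_on_def)
  qed
  define \<pi> where "\<pi> v = (if v \<in> B then \<rho> v else if v \<in> R then g v else v)" for v
  have pB: "\<pi> v = \<rho> v" if "v \<in> B" for v using that by (simp add: \<pi>_def)
  have pR: "\<pi> v = g v" if "v \<in> R" for v using that BR by (auto simp: \<pi>_def)
  have perm: "\<pi> permutes {..<n}"
  proof (rule bij_imp_permutes)
    have "bij_betw \<pi> B (\<rho> ` B)" using rho_inj pB by (simp add: bij_betw_def cong: inj_on_cong image_cong)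
    moreover have "bij_betw \<pi> R Q" using g_bij pR by (simp cong: bij_betw_cong)
    ultimately have "bij_betw \<pi> (B \<union> R) (\<rho> ` B \<union> Q)"
      by (rule bij_betw_combine) (auto simp: Q_def)
    moreover have "\<rho> ` B \<union> Q = {..<n}" using rho_sub by (auto simp: Q_def)
    ultimately show "bij_betw \<pi> {..<n} {..<n}" using BR by simp
    show "\<pi> x = x" if "x \<notin> {..<n}" for x using that by (auto simp: \<pi>_def B_def R_def)
  qed
  have inj: "\<pi> u = \<pi> v \<longleftrightarrow> u = v" for u v using permutes_inj[OF perm] by (auto dest: injD)
  have Rmono: "\<pi> u < \<pi> v" if "u < v" "u \<in> R" "v \<in> R" for u v using that g_mono pR by simp
  have Bmono: "\<pi> u < \<pi> v" if "u < v" "u \<in> B" "v \<in> B" for u v using that rho_mono pB by simp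
  have cardB: "card {u. u < p \<and> u \<in> B} = psupp c p" if "p \<le> n" for p
  proof -
    have "{u. u < p \<and> u \<in> B} = {u. u < p \<and> 0 < c u}" using that by (auto simp: B_def)
    then show ?thesis by (simp add: psupp_eq_card)
  qed
  have cardR: "card {u. u < p \<and> u \<in> R} + psupp c p = p" if "p \<le> n" for p
  proof -
    have "card ({u. u < p \<and> u \<in> R} \<union> {u. u < p \<and> u \<in> B}) = card {u. u < p \<and> u \<in> R} + card {u. u < p \<and> u \<in> B}"
      using BR by (intro card_Un_disjoint) auto
    moreover have "{u. u < p \<and> u \<in> R} \<union> {u. u < p \<and> u \<in> B} = {..<p}" using that by (auto simp: B_def R_def)
    ultimately show ?thesis using cardB[OF that] by simp
  qed
  have before: "card {u. u < n \<and> \<pi> u < \<pi> b} = psum c (Suc b) - 1"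
      "{u. u < n \<and> \<pi> u < \<pi> b \<and> u \<in> B} = {u. u < b \<and> u \<in> B}" if "b \<in> B" for b
  proof -
    have bn: "b < n" using that by (simp add: B_def)
    show "card {u. u < n \<and> \<pi> u < \<pi> b} = psum c (Suc b) - 1"
      using card_below_perm[OF bn perm] pB[OF that] by (simp add: \<rho>_def)
    show "{u. u < n \<and> \<pi> u < \<pi> b \<and> u \<in> B} = {u. u < b \<and> u \<in> B}"
    proof (intro equalityI subsetI)
      fix u assume u: "u \<in> {u. u < n \<and> \<pi> u < \<pi> b \<and> u \<in> B}"
      then show "u \<in> {u. u < b \<and> u \<in> B}"
        using Bmono[of b u] that by (cases u b rule: linorder_cases) auto
    next
      fix u assume "u \<in> {u. u < b \<and> u \<in> B}"
      then show "u \<in> {u. u < n \<and> \<pi> u < \<pi> b \<and> u \<in> B}" using Bmono[OF _ _ that] bn by auto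
    qed
  qed
  have split: "card {u. u < n \<and> \<pi> u < \<pi> b} = psupp c b + card {u. \<pi> u < \<pi> b \<and> u \<in> R}" if "b \<in> B" for b
  proof -
    have "{u. u < n \<and> \<pi> u < \<pi> b} = {u. u < n \<and> \<pi> u < \<pi> b \<and> u \<in> B} \<union> {u. \<pi> u < \<pi> b \<and> u \<in> R}"
      by (auto simp: B_def R_def)
    then have "card {u. u < n \<and> \<pi> u < \<pi> b} = card ({u. u < b \<and> u \<in> B} \<union> {u. \<pi> u < \<pi> b \<and> u \<in> R})"
      using before(2)[OF that] by simp
    also have "\<dots> = card {u. u < b \<and> u \<in> B} + card {u. \<pi> u < \<pi> b \<and> u \<in> R}"
      using BR by (intro card_Un_disjoint) auto
    finally show ?thesis using cardB[of b] that by (simp add: B_def)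
  qed
  have RB: "\<pi> b < \<pi> r" if "b \<in> B" "r \<in> R" "b < r" for b r
  proof (rule ccontr)
    assume "\<not> \<pi> b < \<pi> r"
    then have "\<pi> r < \<pi> b" using inj[of b r] that by auto
    \<comment> \<open>All members of \<open>R\<close> up to \<open>b\<close> precede
      \<open>r\<close>, and with \<open>r\<close> they would lie before \<open>b\<close>: more than
      \<open>psum c (Suc b) \<le> b\<close> leaves room for.\<close>
    have "{u. u < Suc b \<and> u \<in> R} \<subseteq> {u. \<pi> u < \<pi> b \<and> u \<in> R} - {r}"
    proof
      fix u assume "u \<in> {u. u < Suc b \<and> u \<in> R}"
      then have "u < r" "u \<in> R" using that by auto
      then show "u \<in> {u. \<pi> u < \<pi> b \<and> u \<in> R} - {r}" using Rmono[of u r] that \<open>\<pi> r < \<pi> b\<close> by auto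
    qed
    then have "card {u. u < Suc b \<and> u \<in> R} \<le> card ({u. \<pi> u < \<pi> b \<and> u \<in> R} - {r})"
      using BR by (intro card_mono) auto
    also have "\<dots> < card {u. \<pi> u < \<pi> b \<and> u \<in> R}"
      using BR that \<open>\<pi> r < \<pi> b\<close> by (intro psubset_card_mono) auto
    finally have "card {u. u < Suc b \<and> u \<in> R} < card {u. \<pi> u < \<pi> b \<and> u \<in> R}" .
    moreover have "card {u. u < Suc b \<and> u \<in> R} + psupp c (Suc b) = Suc b"
      using that by (intro cardR) (simp add: B_def)
    moreover have "psum c (Suc b) \<le> b" using codesD(3)[OF c] that by (simp add: B_def n_def)
    ultimately show False using split[OF that(1)] before(1)[OF that(1)] that by (simp add: B_def)
  qed
  have ov: "overtaken \<pi> v \<longleftrightarrow> v \<in> B" if "v < n" for v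
  proof
    assume "overtaken \<pi> v"
    then obtain u where u: "u < v" "\<pi> v < \<pi> u" by (auto simp: overtaken_def)
    show "v \<in> B"
    proof (rule ccontr)
      assume "v \<notin> B"
      then have "v \<in> R" using that BR by blast
      moreover have "u \<in> B \<or> u \<in> R" using that u BR by (metis UnE lessThan_iff less_trans)
      ultimately show False using u Rmono[of u v] RB[of u v] by auto
    qed
  next
    assume v: "v \<in> B"
    show "overtaken \<pi> v"
    proof (rule ccontr)
      assume "\<not> overtaken \<pi> v"
      \<comment> \<open>With nothing smaller behind \<open>v\<close>, all \<open>v\<close> smaller
        values lie before it, against \<open>\<rho> v < v\<close>.\<close>
      then have "{u. u < v} \<subseteq> {u. u < n \<and> \<pi> u < \<pi> v}"
        using that inj by (auto simp: overtaken_def) (metis nat_neq_iff)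
      then have "card {u. u < v} \<le> card {u. u < n \<and> \<pi> u < \<pi> v}" by (intro card_mono) auto
      then show False using card_below_perm[OF that perm] pB[OF v] rho_less[OF v] by simp
    qed
  qed
  have pm: "\<pi> \<in> comb_perms s t" unfolding comb_perms_def
  proof (intro CollectI conjI allI impI)
    show "\<pi> permutes {..<s * t}" using perm by (simp add: n_def)
  next
    fix v assume v: "Suc v < s"
    have "s \<le> n" using t by (simp add: n_def)
    then have "v \<in> R" "Suc v \<in> R" using v codesD(1)[OF c] by (auto simp: R_def)
    then show "\<pi> v < \<pi> (Suc v)" by (intro Rmono) auto
  next
    fix v assume "v + s < s * t"
    then have vs: "v + s < n" "v < v + s" using s by (auto simp: n_def)
    then have "v \<in> B \<or> v \<in> R" "v + s \<in> B \<or> v + s \<in> R" by (auto simp: B_def R_def)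
    then consider "v \<in> B" "v + s \<in> B" | "v \<in> R" "v + s \<in> R" | "v \<in> B" "v + s \<in> R" | "v \<in> R" "v + s \<in> B"
      by blast
    then show "\<pi> v < \<pi> (v + s)"
    proof cases
      case 1 then show ?thesis using Bmono vs by blast
    next
      case 2 then show ?thesis using Rmono vs by blast
    next
      case 3 then show ?thesis using RB vs by blast
    next
      \<comment> \<open>The one case that rests on the lower barrier: were \<open>v\<close> behind
        \<open>v + s\<close>, the members of \<open>R\<close> before \<open>v + s\<close> would all
        be below \<open>v\<close>, fewer than the barrier forces.\<close>
      case 4
      show ?thesis
      proof (rule ccontr)
        assume "\<not> \<pi> v < \<pi> (v + s)"
        then have less: "\<pi> (v + s) < \<pi> v" using inj[of v "v + s"] vs by auto
        have "{u. \<pi> u < \<pi> (v + s) \<and> u \<in> R} \<subseteq> {u. u < v \<and> u \<in> R}"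
        proof clarify
          fix u assume u: "\<pi> u < \<pi> (v + s)" "u \<in> R"
          show "u < v"
            using u less Rmono[of v u] 4 by (cases u v rule: linorder_cases) auto
        qed
        then have "card {u. \<pi> u < \<pi> (v + s) \<and> u \<in> R} \<le> card {u. u < v \<and> u \<in> R}"
          using BR by (intro card_mono) auto
        moreover have "card {u. u < v \<and> u \<in> R} + psupp c v = v" using vs by (intro cardR) auto
        moreover have "Suc (v + s) + psupp c (Suc (v + s)) \<le> psum c (Suc (v + s)) + s + psupp c (Suc v)"
          using codesD(4)[OF c, of "v + s"] 4 by (simp add: B_def R_def)
        ultimately show False using split[OF 4(2)] before(1)[OF 4(2)] 4 by (simp add: B_def R_def)
      qed
    qed
  next
    fix x y z assume xyz: "x < y \<and> y < z \<and> z < s * t"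
    \<comment> \<open>Two of the three values share a class, and both classes are placed
      increasingly.\<close>
    then have "x \<in> B \<or> x \<in> R" "y \<in> B \<or> y \<in> R" "z \<in> B \<or> z \<in> R" by (auto simp: B_def R_def n_def)
    then show "\<not> (\<pi> z < \<pi> y \<and> \<pi> y < \<pi> x)"
      using Bmono[of x y] Bmono[of y z] Bmono[of x z] Rmono[of x y] Rmono[of y z] Rmono[of x z] xyz by auto
  qed
  have top: "top_pos \<pi> p = psum c p" if "p \<le> n" for p
    using that
  proof (induction p)
    case (Suc p)
    show ?case
    proof (cases "p \<in> B")
      case True
      then show ?thesis using ov[of p] Suc.prems pB[OF True] Suc_rho[OF True] by simp
    next
      case False
      then have "c p = 0" using Suc.prems by (simp add: B_def)
      then show ?thesis using False ov[of p] Suc by simp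
    qed
  qed simp
  have "code_of \<pi> v = c v" for v
  proof (cases "v < n")
    case True
    then show ?thesis using top[of v] top[of "Suc v"] by (simp add: code_of_def del: top_pos.simps)
  next
    case False
    then have "c v = 0" "code_of \<pi> v = 0"
      using codesD(2)[OF c] codesD(2)[OF code_of_in_codes[OF pm]] by (auto simp: n_def)
    then show ?thesis by simp
  qed
  then show ?thesis using pm by blast
qed

lemma A321_K_eq_card_codes:
  assumes "1 \<le> s" "1 \<le> t"
  shows "A321_K s t = card (codes 0 s t)"
proof -
  have "bij_betw code_of (comb_perms s t) (codes 0 s t)"
    using inj_on_code_of code_of_in_codes comb_perm_of_code[OF _ assms] unfolding bij_betw_def by blast
  then show ?thesis using A321_K_eq_card_comb_perms[OF assms(2)] bij_betw_same_card by fastforce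
qed

section \<open>Interleaving codes of the same type\<close>

lemma psum_blocks: "psum c (k * p) = (\<Sum>q<p. \<Sum>l<k. c (k * q + l))"
proof (induction p)
  case (Suc p)
  have "psum c (k * p + d) = psum c (k * p) + (\<Sum>l<d. c (k * p + l))" for d
    by (induction d) auto
  from this[of k] show ?case using Suc by (simp add: add.commute)
qed simp

lemma psupp_blocks: "psupp c (k * p) = (\<Sum>q<p. \<Sum>l<k. of_bool (0 < c (k * q + l)))"
  unfolding psupp_def by (rule psum_blocks)

text \<open>The type of a code records exactly what happens where a prefix count crosses a multiple of
  \<open>m\<close>. Codes of the same type agree up to \<open>m\<close> in all prefix counts, and every entry on
  which they may differ is less than \<open>m\<close>.\<close>

definition jumps :: "nat \<Rightarrow> (nat \<Rightarrow> nat) \<Rightarrow> nat \<Rightarrow> bool" where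
  "jumps m f p \<longleftrightarrow> f (Suc p) div m \<noteq> f p div m"

definition code_type :: "nat \<Rightarrow> nat \<Rightarrow> (nat \<Rightarrow> nat) \<Rightarrow> (nat \<times> nat \<times> nat \<times> nat) set" where
  "code_type n m c = (\<lambda>p. (p, psum c p, psum c (Suc p), psupp c (Suc p))) `
     {p. p < n \<and> (jumps m (psum c) p \<or> jumps m (psupp c) p)}"

lemma code_type_jumps:
  assumes eq: "code_type n m c = code_type n m d" and "p < n"
    and "jumps m (psum c) p \<or> jumps m (psupp c) p"
  shows "psum d p = psum c p" "psum d (Suc p) = psum c (Suc p)" "psupp d (Suc p) = psupp c (Suc p)"
    "jumps m (psum d) p \<or> jumps m (psupp d) p" "d p = c p"
proof -
  \<comment> \<open>A quadruple starts with its index, so a shared quadruple comes from the same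
    \<open>p\<close> in both codes.\<close>
  have "(p, psum c p, psum c (Suc p), psupp c (Suc p)) \<in> code_type n m d"
    unfolding eq[symmetric] unfolding code_type_def using assms(2,3) by (intro image_eqI[of _ _ p]) simp_all
  then show *: "psum d p = psum c p" "psum d (Suc p) = psum c (Suc p)" "psupp d (Suc p) = psupp c (Suc p)"
    "jumps m (psum d) p \<or> jumps m (psupp d) p"
    unfolding code_type_def by (elim imageE CollectE conjE; simp del: psupp_Suc sum.lessThan_Suc)+
  show "d p = c p" using *(1,2) by simp
qed

text \<open>The quotients by \<open>m\<close> change only at jumps, where the type stores exact
  values; both codes jump at the same indices.\<close>

lemma code_type_div:
  assumes eq: "code_type n m c = code_type n m d" and "p \<le> n"
  shows "psum c p div m = psum d p div m \<and> psupp c p div m = psupp d p div m"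
  using assms(2)
proof (induction p)
  case (Suc p)
  show ?case
  proof (cases "jumps m (psum c) p \<or> jumps m (psupp c) p")
    case True
    then show ?thesis using code_type_jumps[OF eq _ True] Suc.prems by simp
  next
    case False
    moreover have "\<not> (jumps m (psum d) p \<or> jumps m (psupp d) p)"
      using False code_type_jumps(4)[OF eq[symmetric], of p] Suc.prems by auto
    ultimately show ?thesis using Suc by (simp add: jumps_def)
  qed
qed simp

lemma code_type_psum_jumps:
  assumes eq: "code_type n m c = code_type n m d" and "p < n"
  shows "jumps m (psum c) p \<longleftrightarrow> jumps m (psum d) p"
  using code_type_div[OF eq, of p] code_type_div[OF eq, of "Suc p"] assms(2) by (simp add: jumps_def)

lemma div_eq_imp_le_add: "x div m = y div m \<Longrightarrow> 0 < m \<Longrightarrow> x \<le> y + m" for x y m :: nat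
  by (metis add.commute add_le_mono div_mult_mod_eq le_add1 mod_le_divisor order.trans add.left_commute)

text \<open>A large entry must be spent on the first of the \<open>k\<close> copies, to keep the partial sums
  of the interleaving high enough; no information is lost because the type determines it.\<close>

definition interleave :: "nat \<Rightarrow> nat \<Rightarrow> (nat \<Rightarrow> nat) \<Rightarrow> (nat \<Rightarrow> nat \<Rightarrow> nat) \<Rightarrow> nat \<Rightarrow> nat" where
  "interleave m k c F I = (let p = I div k; l = I mod k in
     if jumps m (psum c) p then (if l = 0 then k * (c p - 1) + 1 else 1) else F l p)"

text \<open>The representative \<open>c\<close> is fixed for the whole class, so its jumps are known
  when an interleaving is decoded.\<close>

locale same_type =
  fixes s t m k :: nat and c :: "nat \<Rightarrow> nat" and F :: "nat \<Rightarrow> nat \<Rightarrow> nat"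
  assumes m_pos: "0 < m" and k_pos: "0 < k"
    and F_codes: "\<And>l. l < k \<Longrightarrow> F l \<in> codes 0 s t"
    and c_codes: "c \<in> codes 0 s t"
    and F_type: "\<And>l. l < k \<Longrightarrow> code_type (s * t) m (F l) = code_type (s * t) m c"
begin

abbreviation "G \<equiv> interleave m k c F"

lemma G_at: "l < k \<Longrightarrow> G (k * p + l) =
    (if jumps m (psum c) p then (if l = 0 then k * (c p - 1) + 1 else 1) else F l p)"
  by (simp add: interleave_def Let_def)

lemma jump_less: "jumps m (psum c) p \<Longrightarrow> p < s * t"
  using codesD(2)[OF c_codes, of p] by (cases "p < s * t") (auto simp: jumps_def)

lemma jump_pos: "jumps m (psum c) p \<Longrightarrow> 0 < c p"
  by (cases "c p") (auto simp: jumps_def)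

lemma jump_eq: "jumps m (psum c) p \<Longrightarrow> l < k \<Longrightarrow> F l p = c p \<and> psum (F l) p = psum c p"
  using code_type_jumps[OF F_type[symmetric], of l p] jump_less by auto

text \<open>Every copy has a positive entry at a jump, so redistributing the jump entries leaves the
  support intact.\<close>

lemma G_pos_iff: "l < k \<Longrightarrow> 0 < G (k * p + l) \<longleftrightarrow> 0 < F l p"
  using jump_pos jump_eq by (auto simp: G_at)

lemma psum_G: "psum G (k * p) = (\<Sum>l<k. psum (F l) p)"
proof -
  have "(\<Sum>l<k. G (k * q + l)) = (\<Sum>l<k. F l q)" for q
  proof (cases "jumps m (psum c) q")
    case True
    have "(\<Sum>l<k. G (k * q + l)) = (\<Sum>l<k. (if l = 0 then k * (c q - 1) else 0) + 1)"
      using True by (intro sum.cong) (auto simp: G_at)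
    also have "\<dots> = (\<Sum>l<k. if l = 0 then k * (c q - 1) else 0) + (\<Sum>l<k. 1)" by (rule sum.distrib)
    also have "\<dots> = k * (c q - 1) + k" using k_pos by (simp add: sum.delta)
    also have "\<dots> = k * c q" using jump_pos[OF True] by (cases "c q") auto
    also have "\<dots> = (\<Sum>l<k. F l q)" using jump_eq[OF True] by simp
    finally show ?thesis .
  next
    case False
    then show ?thesis by (intro sum.cong) (auto simp: G_at)
  qed
  then have "psum G (k * p) = (\<Sum>q<p. \<Sum>l<k. F l q)" by (simp add: psum_blocks)
  also have "\<dots> = (\<Sum>l<k. psum (F l) p)" by (rule sum.swap)
  finally show ?thesis .
qed

lemma psupp_G: "psupp G (k * p) = (\<Sum>l<k. psupp (F l) p)"
proof -
  have "psupp G (k * p) = (\<Sum>q<p. \<Sum>l<k. of_bool (0 < F l q))"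
    unfolding psupp_blocks using G_pos_iff by (intro sum.cong refl) auto
  also have "\<dots> = (\<Sum>l<k. psupp (F l) p)" unfolding psupp_def by (rule sum.swap)
  finally show ?thesis .
qed

lemma F_close:
  assumes "l < k" "l' < k" "p \<le> s * t"
  shows "psum (F l) p \<le> psum (F l') p + m" and "psupp (F l) p \<le> psupp (F l') p + m"
proof -
  have "code_type (s * t) m (F l) = code_type (s * t) m (F l')" using F_type assms by simp
  from code_type_div[OF this assms(3)]
  show "psum (F l) p \<le> psum (F l') p + m" "psupp (F l) p \<le> psupp (F l') p + m"
    using m_pos by (auto intro: div_eq_imp_le_add)
qed

text \<open>At a jump, the lump on copy 0 already supplies all but at most \<open>k\<close> of the
  total \<open>k * c p\<close>. Elsewhere \<open>psum (F l) (Suc p)\<close> still has the quotient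
  by \<open>m\<close> that all copies share at \<open>p\<close>.\<close>

lemma psum_G_ge:
  assumes "l < k" "p < s * t"
  shows "k * psum (F l) (Suc p) \<le> psum G (Suc (k * p + l)) + k * m"
proof (cases "jumps m (psum c) p")
  case True
  have "k * psum (F l) (Suc p) = k * psum c p + k * c p"
    using jump_eq[OF True assms(1)] by (simp add: algebra_simps)
  also have "k * psum c p = psum G (k * p)"
    using jump_eq[OF True] by (simp add: psum_G)
  also have "psum G (k * p) + k * c p \<le> psum G (k * p) + G (k * p) + k"
  proof -
    have "k * c p \<le> k * (c p - 1) + 1 + k" using jump_pos[OF True] by (cases "c p") auto
    then show ?thesis using G_at[OF k_pos, of p] True by simp
  qed
  also have "\<dots> = psum G (Suc (k * p)) + k" by simp
  also have "\<dots> \<le> psum G (Suc (k * p + l)) + k * m"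
    using psum_mono[of "Suc (k * p)" "Suc (k * p + l)" G] m_pos by (intro add_mono) auto
  finally show ?thesis .
next
  case False
  have "psum (F l) (Suc p) \<le> psum (F l') p + m" if "l' < k" for l'
  proof -
    have "\<not> jumps m (psum (F l)) p"
      using False code_type_psum_jumps[OF F_type[OF assms(1)] assms(2)] by simp
    then have "psum (F l) (Suc p) div m = psum (F l) p div m" by (simp add: jumps_def)
    also have "\<dots> = psum (F l') p div m"
      using code_type_div[of "s * t" m "F l" "F l'" p] F_type assms that by simp
    finally show ?thesis using m_pos by (rule div_eq_imp_le_add)
  qed
  then have "(\<Sum>l'<k. psum (F l) (Suc p)) \<le> (\<Sum>l'<k. psum (F l') p + m)"
    by (intro sum_mono) auto
  then have "k * psum (F l) (Suc p) \<le> psum G (k * p) + k * m"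
    by (simp add: psum_G sum.distrib del: sum.lessThan_Suc)
  also have "\<dots> \<le> psum G (Suc (k * p + l)) + k * m"
    by (intro add_mono psum_mono) auto
  finally show ?thesis .
qed

text \<open>The upper barrier survives exactly, since the copies together contribute at most
  \<open>k * p\<close> up to the end of group \<open>p\<close>. For the lower one, \<open>k\<close>
  times the constraint of copy \<open>l\<close> is compared with the prefix counts of
  \<open>G\<close>.\<close>

lemma interleave_in_codes: "G \<in> codes (4 * k * m) (k * s) t"
  unfolding codes_def
proof (intro CollectI conjI allI impI)
  fix I
  define p l where "p = I div k" and "l = I mod k"
  have l: "l < k" and I: "I = k * p + l" using k_pos by (auto simp: p_def l_def)
  have range: "p < s \<longleftrightarrow> I < k * s" "p < s * t \<longleftrightarrow> I < k * s * t"
    unfolding p_def using div_less_iff_less_mult[OF k_pos] by (simp_all add: ac_simps)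
  show "G I = 0" if "I < k * s \<or> k * s * t \<le> I"
  proof -
    have "F l p = 0" using that range codesD(1,2)[OF F_codes[OF l], of p] by (metis not_le)
    then show ?thesis using G_pos_iff[OF l, of p] I by simp
  qed
  show "psum G (Suc I) \<le> I" if "I < k * s * t"
  proof -
    have "psum G (Suc I) \<le> psum G (k * Suc p)" using l I by (intro psum_mono) auto
    also have "\<dots> = (\<Sum>l<k. psum (F l) (Suc p))" by (rule psum_G)
    also have "\<dots> \<le> (\<Sum>l<k. p)" using codesD(3)[OF F_codes] range that
      by (intro sum_mono) auto
    also have "\<dots> \<le> I" by (simp add: I)
    finally show ?thesis .
  qed
  show "Suc I + psupp G (Suc I) \<le> psum G (Suc I) + k * s + psupp G (Suc (I - k * s)) + 4 * k * m"
    if "k * s \<le> I" "0 < G I \<and> G (I - k * s) = 0"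
  proof -
    have ps: "s \<le> p" using that range by auto
    have I': "I - k * s = k * (p - s) + l" using ps I by (simp add: diff_mult_distrib2)
    have pos: "0 < F l p" "F l (p - s) = 0"
      using that G_pos_iff[OF l, of p] G_pos_iff[OF l, of "p - s"] I I' by auto
    have pn: "p < s * t" using pos codesD(2)[OF F_codes[OF l], of p] by (cases "p < s * t") auto
    have "Suc p + psupp (F l) (Suc p) \<le> psum (F l) (Suc p) + s + psupp (F l) (Suc (p - s))"
      using codesD(4)[OF F_codes[OF l] ps pos] by simp
    then have main: "k * (Suc p + psupp (F l) (Suc p)) \<le> k * (psum (F l) (Suc p) + s + psupp (F l) (Suc (p - s)))"
      by (rule mult_le_mono2)
    have "psupp G (Suc I) \<le> psupp G (k * Suc p)" using l I by (intro psupp_mono) auto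
    also have "\<dots> = (\<Sum>l'<k. psupp (F l') (Suc p))" by (rule psupp_G)
    also have "\<dots> \<le> (\<Sum>l'<k. psupp (F l) (Suc p) + m)" using F_close(2)[OF _ l, of _ "Suc p"] pn
      by (intro sum_mono) auto
    finally have h1: "psupp G (Suc I) \<le> k * psupp (F l) (Suc p) + k * m"
      by (simp add: distrib_left del: psupp_Suc)
    have "k * psupp (F l) (Suc (p - s)) \<le> k * psupp (F l) (p - s) + k"
      by (auto simp: of_bool_def)
    also have "k * psupp (F l) (p - s) = (\<Sum>l'<k. psupp (F l) (p - s))" by simp
    also have "\<dots> \<le> (\<Sum>l'<k. psupp (F l') (p - s) + m)" using F_close(2)[OF l, of _ "p - s"] pn
      by (intro sum_mono) auto
    also have "\<dots> = psupp G (k * (p - s)) + k * m" by (simp add: psupp_G sum.distrib)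
    also have "psupp G (k * (p - s)) \<le> psupp G (Suc (I - k * s))" by (intro psupp_mono) (simp add: I')
    finally have h2: "k * psupp (F l) (Suc (p - s)) \<le> psupp G (Suc (I - k * s)) + k * m + k" by simp
    have h3: "k * psum (F l) (Suc p) \<le> psum G (Suc I) + k * m" using psum_G_ge[OF l pn] I by simp
    have h4: "Suc I \<le> k * Suc p" using l I by simp
    have h5: "k \<le> k * m" using m_pos by simp
    \<comment> \<open>The violation is \<open>k * m\<close> from each of \<open>h1\<close>,
      \<open>h2\<close>, \<open>h3\<close>, and a further \<open>k \<le> k * m\<close> from
      \<open>h2\<close>.\<close>
    show ?thesis using main h1 h2 h3 h4 h5
      unfolding distrib_left by linarith
  qed
qed

end

text \<open>At jumps every copy has the entry \<open>c p\<close>; elsewhere the entries are read off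
  directly.\<close>

lemma inj_on_interleave:
  assumes k: "0 < k" and c: "c \<in> codes 0 s t"
    and C: "\<And>d. d \<in> C \<Longrightarrow> d \<in> codes 0 s t \<and> code_type (s * t) m d = code_type (s * t) m c"
    and m: "0 < m"
  shows "inj_on (interleave m k c) ({..<k} \<rightarrow>\<^sub>E C)"
proof (rule inj_onI)
  fix F F' assume F: "F \<in> {..<k} \<rightarrow>\<^sub>E C" "F' \<in> {..<k} \<rightarrow>\<^sub>E C" and eq: "interleave m k c F = interleave m k c F'"
  have "same_type s t m k c F" "same_type s t m k c F'"
    using F C k m c by (auto simp: same_type_def PiE_iff)
  note at = same_type.G_at[OF this(1)] same_type.G_at[OF this(2)]
    same_type.jump_eq[OF this(1)] same_type.jump_eq[OF this(2)]
  have "F l p = F' l p" if "l < k" for l p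
    using at(3,4)[OF _ that] at(1)[OF that, of p] at(2)[OF that, of p] eq by (cases "jumps m (psum c) p") auto
  then have "F l = F' l" if "l < k" for l using that by blast
  then show "F = F'" using F by (intro PiE_ext) auto
qed

section \<open>Counting the types\<close>

lemma card_jumps_le:
  assumes "\<And>p. f p \<le> f (Suc p)" "f 0 = 0"
  shows "card {p. p < n \<and> jumps m f p} \<le> f n div m"
proof (induction n)
  case (Suc n)
  have eq: "{p. p < Suc n \<and> jumps m f p} = (if jumps m f n then insert n {p. p < n \<and> jumps m f p} else {p. p < n \<and> jumps m f p})"
    by (auto simp: less_Suc_eq)
  have "f n div m \<le> f (Suc n) div m" using assms(1) by (rule div_le_mono)
  then show ?case using Suc eq by (auto simp: jumps_def)
qed simp

text \<open>Lists of length \<open>K\<close>, with \<open>None\<close> as filler, cover all these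
  sets.\<close>

lemma card_subsets_card_le:
  assumes "finite U"
  shows "card {A. A \<subseteq> U \<and> card A \<le> K} \<le> (card U + 1) ^ K"
proof -
  let ?L = "{xs. set xs \<subseteq> insert None (Some ` U) \<and> length xs = K}"
  have finL: "finite ?L" using assms by (intro finite_lists_length_eq) auto
  have "{A. A \<subseteq> U \<and> card A \<le> K} \<subseteq> (\<lambda>xs. {u. Some u \<in> set xs}) ` ?L"
  proof
    fix A assume "A \<in> {A. A \<subseteq> U \<and> card A \<le> K}"
    then have A: "A \<subseteq> U" "card A \<le> K" by auto
    then obtain ys where ys: "set ys = A" "length ys = card A"
      using assms finite_distinct_list[of A] distinct_card finite_subset by metis
    let ?xs = "map Some ys @ replicate (K - card A) None"
    have "?xs \<in> ?L" using A ys by (auto split: if_splits)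
    moreover have "A = {u. Some u \<in> set ?xs}" using ys by auto
    ultimately show "A \<in> (\<lambda>xs. {u. Some u \<in> set xs}) ` ?L" by blast
  qed
  then have "card {A. A \<subseteq> U \<and> card A \<le> K} \<le> card ?L" using finL by (rule surj_card_le[rotated])
  also have "\<dots> = card (insert None (Some ` U)) ^ K" using assms by (intro card_lists_length_eq) auto
  also have "card (insert None (Some ` U)) = card U + 1" using assms
    by (subst card_insert_disjoint) (auto simp: card_image)
  finally show ?thesis .
qed

definition type_bound :: "nat \<Rightarrow> nat \<Rightarrow> nat" where
  "type_bound n m = (Suc n ^ 4 + 1) ^ (2 * (n div m))"

text \<open>Both prefix counts are monotone and at most \<open>s * t\<close>, and each jump raises a
  quotient by \<open>m\<close>. So a type is a set of few quadruples with bounded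
  components.\<close>

lemma card_code_types: "card (code_type (s * t) m ` codes 0 s t) \<le> type_bound (s * t) m"
proof -
  define n where "n = s * t"
  define U where "U = {..n} \<times> {..n} \<times> {..n} \<times> {..n}"
  have "code_type n m c \<in> {A. A \<subseteq> U \<and> card A \<le> 2 * (n div m)}" if "c \<in> codes 0 s t" for c
  proof -
    let ?S = "{p. p < n \<and> jumps m (psum c) p}" and ?H = "{p. p < n \<and> jumps m (psupp c) p}"
    have le: "psum c p \<le> n" "psupp c p \<le> n" for p
      using codes_psum_le[OF that, of p] psupp_le_psum[of c p] by (auto simp: n_def)
    have "code_type n m c \<subseteq> U"
      unfolding code_type_def U_def using le by (auto simp del: sum.lessThan_Suc psupp_Suc)
    moreover have "card (code_type n m c) \<le> 2 * (n div m)"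
    proof -
      have "card (code_type n m c) \<le> card {p. p < n \<and> (jumps m (psum c) p \<or> jumps m (psupp c) p)}"
        unfolding code_type_def by (intro card_image_le) auto
      also have "\<dots> = card (?S \<union> ?H)" by (rule arg_cong[where f = card]) auto
      also have "\<dots> \<le> card ?S + card ?H" by (rule card_Un_le)
      also have "\<dots> \<le> psum c n div m + psupp c n div m"
        by (intro add_mono card_jumps_le) auto
      also have "\<dots> \<le> n div m + n div m" using le by (intro add_mono div_le_mono)
      finally show ?thesis by simp
    qed
    ultimately show ?thesis by simp
  qed
  then have "card (code_type n m ` codes 0 s t) \<le> card {A. A \<subseteq> U \<and> card A \<le> 2 * (n div m)}"
    by (intro card_mono) (auto simp: U_def intro: finite_subset[of _ "Pow U"])
  also have "\<dots> \<le> (card U + 1) ^ (2 * (n div m))" by (intro card_subsets_card_le) (simp add: U_def)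
  also have "card U = Suc n ^ 4" by (simp add: U_def power4_eq_xxxx mult.assoc)
  finally show ?thesis by (simp add: n_def type_bound_def)
qed

text \<open>Some type class has at least average size, and its \<open>k\<close>-tuples interleave
  injectively.\<close>

lemma card_codes_interleave:
  assumes "0 < m" "0 < k"
  shows "card (codes 0 s t) ^ k \<le> type_bound (s * t) m ^ k * card (codes (4 * k * m) (k * s) t)"
proof -
  let ?T = "code_type (s * t) m"
  let ?K = "codes 0 s t"
  let ?N = "card (codes (4 * k * m) (k * s) t)"
  have ne: "?K \<noteq> {}"
  proof -
    have "(\<lambda>_. 0) \<in> ?K" by (auto simp: codes_def)
    then show ?thesis by blast
  qed
  have "\<exists>\<tau> \<in> ?T ` ?K. card ?K \<le> card (?T ` ?K) * card {d \<in> ?K. ?T d = \<tau>}"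
  proof (rule ccontr)
    assume "\<not> ?thesis"
    then have less: "card (?T ` ?K) * card {d \<in> ?K. ?T d = \<tau>} < card ?K" if "\<tau> \<in> ?T ` ?K" for \<tau>
      using that by (meson not_le)
    have "card ?K = (\<Sum>\<tau>\<in>?T ` ?K. card {d \<in> ?K. ?T d = \<tau>})"
      using sum.image_gen[OF finite_codes, of "\<lambda>_. 1 :: nat" 0 s t ?T] by simp
    then have "card (?T ` ?K) * card ?K = (\<Sum>\<tau>\<in>?T ` ?K. card (?T ` ?K) * card {d \<in> ?K. ?T d = \<tau>})"
      by (simp add: sum_distrib_left)
    also have "\<dots> < (\<Sum>\<tau>\<in>?T ` ?K. card ?K)"
      using ne less finite_codes by (intro sum_strict_mono) auto
    finally show False by simp
  qed
  then obtain \<tau> where \<tau>: "\<tau> \<in> ?T ` ?K" "card ?K \<le> card (?T ` ?K) * card {d \<in> ?K. ?T d = \<tau>}"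
    by blast
  then obtain c where c: "c \<in> ?K" "?T c = \<tau>" by blast
  define C where "C = {d \<in> ?K. ?T d = \<tau>}"
  have finC: "finite C" using finite_codes by (auto simp: C_def)
  have "card ({..<k} \<rightarrow>\<^sub>E C) \<le> ?N"
  proof (rule card_inj_on_le)
    show "inj_on (interleave m k c) ({..<k} \<rightarrow>\<^sub>E C)"
      using assms c by (intro inj_on_interleave[where s = s and t = t]) (auto simp: C_def)
    show "interleave m k c ` ({..<k} \<rightarrow>\<^sub>E C) \<subseteq> codes (4 * k * m) (k * s) t"
    proof
      fix G assume "G \<in> interleave m k c ` ({..<k} \<rightarrow>\<^sub>E C)"
      then obtain F where F: "F \<in> {..<k} \<rightarrow>\<^sub>E C" "G = interleave m k c F" by blast
      have "same_type s t m k c F"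
        using F assms c by (auto simp: same_type_def C_def PiE_iff)
      then show "G \<in> codes (4 * k * m) (k * s) t" using F same_type.interleave_in_codes by blast
    qed
  qed (rule finite_codes)
  then have "card C ^ k \<le> ?N" by (simp add: card_PiE)
  moreover have "card ?K \<le> type_bound (s * t) m * card C"
    using \<tau>(2) card_code_types[of s t m] unfolding C_def by (meson mult_le_mono1 order.trans)
  then have "card ?K ^ k \<le> (type_bound (s * t) m * card C) ^ k" by (rule power_mono) simp
  ultimately show ?thesis by (simp add: power_mult_distrib) (meson mult_le_mono2 order.trans)
qed

section \<open>Padding with additional columns\<close>

text \<open>Each row is prefixed with \<open>D\<close> new columns. The last of them carries a nonzero entry, which
  raises the partial sums in row \<open>j\<close> by \<open>(j + 1) * D\<close>: that is \<open>D\<close> more than the lower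
  constraint asks for, and just within the upper constraint.\<close>

definition padding :: "nat \<Rightarrow> nat \<Rightarrow> nat \<Rightarrow> nat" where
  "padding D t j = (if j = 0 \<or> t \<le> j then 0 else if j = 1 then 2 * D else D)"

definition pad :: "nat \<Rightarrow> nat \<Rightarrow> nat \<Rightarrow> (nat \<Rightarrow> nat) \<Rightarrow> nat \<Rightarrow> nat" where
  "pad D s t c I = (let j = I div (s + D); i = I mod (s + D) in
     if Suc i < D then 0 else if Suc i = D then padding D t j else c (j * s + (i - D)))"

lemma pad_at: "i < s + D \<Longrightarrow> pad D s t c (j * (s + D) + i) =
    (if Suc i < D then 0 else if Suc i = D then padding D t j else c (j * s + (i - D)))"
  by (simp add: pad_def Let_def)

text \<open>The truncated \<open>x - D\<close> freezes the prefix of \<open>c\<close> while the new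
  columns are passed. For \<open>x < D\<close> the padding of row \<open>j\<close> is still ahead,
  and for \<open>j \<ge> 2\<close> the earlier rows have given
  \<open>2 * D + (j - 2) * D\<close>.\<close>

lemma psum_pad:
  assumes "0 < D" "j < t" "x \<le> s + D"
  shows "psum (pad D s t c) (j * (s + D) + x) = psum c (j * s + (x - D)) +
    (if x < D then if j \<le> 1 then 0 else j * D else if j = 0 then 0 else (j + 1) * D)"
  using assms(2,3)
proof (induction j arbitrary: x)
  case 0
  from 0(2) show ?case
  proof (induction x)
    case (Suc x)
    then show ?case using assms(1) pad_at[of x s D t c 0]
      by (auto simp: padding_def Suc_diff_le not_less less_Suc_eq_le)
  qed (use assms in simp)
next
  case (Suc j)
  from Suc.prems(2) show ?case
  proof (induction x)
    case 0
    have "psum (pad D s t c) (j * (s + D) + (s + D)) = psum c (Suc j * s) + (if j = 0 then 0 else (j + 1) * D)"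
      using Suc.IH[of "s + D"] Suc.prems by (simp add: add.commute)
    then show ?case using assms by (simp add: algebra_simps)
  next
    case (Suc x)
    have "psum (pad D s t c) (Suc j * (s + D) + Suc x) =
        psum (pad D s t c) (Suc j * (s + D) + x) + pad D s t c (Suc j * (s + D) + x)" by simp
    note step = this Suc assms(1) \<open>Suc j < t\<close> pad_at[of x s D t c "Suc j"]
    show ?case
    proof (cases "D = Suc x")
      case True
      then show ?thesis using step by (simp add: padding_def)
    next
      case False
      then have "D \<le> Suc x \<longleftrightarrow> D \<le> x" by auto
      then show ?thesis using step
        by (auto simp: padding_def Suc_diff_le not_less less_Suc_eq_le algebra_simps)
    qed
  qed
qed

lemma psupp_pad:
  assumes "0 < D" "j < t" "x \<le> s + D"
  shows "psupp (pad D s t c) (j * (s + D) + x) = psupp c (j * s + (x - D)) + (if x < D then j - 1 else j)"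
  using assms(2,3)
proof (induction j arbitrary: x)
  case 0
  from 0(2) show ?case
  proof (induction x)
    case (Suc x)
    then show ?case using assms(1) pad_at[of x s D t c 0]
      by (auto simp: padding_def Suc_diff_le not_less less_Suc_eq_le)
  qed (use assms in simp)
next
  case (Suc j)
  from Suc.prems(2) show ?case
  proof (induction x)
    case 0
    have "psupp (pad D s t c) (j * (s + D) + (s + D)) = psupp c (Suc j * s) + j"
      using Suc.IH[of "s + D"] Suc.prems by (simp add: add.commute)
    then show ?case using assms by (simp add: algebra_simps)
  next
    case (Suc x)
    have "psupp (pad D s t c) (Suc j * (s + D) + Suc x) =
        psupp (pad D s t c) (Suc j * (s + D) + x) + of_bool (0 < pad D s t c (Suc j * (s + D) + x))" by simp
    note step = this Suc assms(1) \<open>Suc j < t\<close> pad_at[of x s D t c "Suc j"]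
    show ?case
    proof (cases "D = Suc x")
      case True
      then show ?thesis using step by (simp add: padding_def)
    next
      case False
      then have "D \<le> Suc x \<longleftrightarrow> D \<le> x" by auto
      then show ?thesis using step
        by (auto simp: padding_def Suc_diff_le not_less less_Suc_eq_le algebra_simps)
    qed
  qed
qed

lemma pad_in_codes:
  assumes c: "c \<in> codes e s t" and D: "e < D" and s: "0 < s" 
  shows "pad D s t c \<in> codes 0 (s + D) t"
  unfolding codes_def
proof (intro CollectI conjI allI impI)
  let ?s = "s + D"
  fix I
  define j i where "j = I div ?s" and "i = I mod ?s"
  have i: "i < ?s" and I: "I = j * ?s + i" using s by (simp_all only: j_def i_def div_mult_mod_eq) simp
  have range: "I < ?s \<longleftrightarrow> j = 0" "I < ?s * t \<longleftrightarrow> j < t"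
    using s div_less_iff_less_mult[of ?s I t] div_less_iff_less_mult[of ?s I 1]
    by (auto simp: j_def mult.commute)
  have D0: "0 < D" using D by simp
  show "pad D s t c I = 0" if "I < ?s \<or> ?s * t \<le> I"
  proof -
    have j: "j = 0 \<or> t \<le> j" using that range by auto
    moreover have "c (j * s + (i - D)) = 0" if "D \<le> i"
    proof (cases "j = 0")
      case True
      then show ?thesis using codesD(1)[OF c] that i by auto
    next
      case False
      then have "t * s \<le> j * s" using j by (intro mult_le_mono1) auto
      then have "s * t \<le> j * s + (i - D)" by (simp only: mult.commute[of t] trans_le_add1)
      then show ?thesis by (rule codesD(2)[OF c])
    qed
    ultimately show ?thesis using pad_at[OF i, of t c j] I by (auto simp: padding_def)
  qed
  show "psum (pad D s t c) (Suc I) \<le> I" if "I < ?s * t"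
  proof -
    have jt: "j < t" using that range by simp
    have eq: "psum (pad D s t c) (Suc I) = psum c (j * s + (Suc i - D)) +
      (if Suc i < D then if j \<le> 1 then 0 else j * D else if j = 0 then 0 else (j + 1) * D)"
      using psum_pad[OF D0 jt, of "Suc i" s c] i by (simp add: I)
    \<comment> \<open>At \<open>p = j * s + (Suc i - D)\<close> with \<open>D \<le> Suc i\<close>,
      adding the gain \<open>(j + 1) * D\<close> to this bound yields exactly
      \<open>I\<close>.\<close>
    have le: "psum c p \<le> p - 1" if "p \<le> s * t" for p
    proof (cases p)
      case (Suc q)
      then show ?thesis using codesD(3)[OF c, of q] that by simp
    qed simp
    have rows: "j * s + s \<le> s * t"
      using mult_le_mono2[of "Suc j" t s] jt by (simp add: algebra_simps)
    have bound: "psum c (j * s + (Suc i - D)) \<le> j * s + (Suc i - D) - 1"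
      using rows i by (intro le) auto
    show ?thesis
    proof (cases "j = 0")
      case True
      then have "psum c (Suc i - D) = 0" using codesD(1)[OF c] i by auto
      then show ?thesis using eq True by simp
    next
      case False
      then obtain X Y where X: "X = j * s" "s \<le> X" "Y = j * D" by simp
      have I2: "I = X + Y + i" using I X by (simp add: algebra_simps)
      have "psum c (j * s + (Suc i - D)) + (if Suc i < D then if j \<le> 1 then 0 else Y else Y + D) \<le> I"
        using bound X(2) s D0 unfolding I2 X(1)[symmetric] by (auto split: if_splits)
      then show ?thesis using eq False X(3) by (simp add: add.commute split: if_splits)
    qed
  qed
  show "Suc I + psupp (pad D s t c) (Suc I) \<le>
      psum (pad D s t c) (Suc I) + ?s + psupp (pad D s t c) (Suc (I - ?s)) + 0"
    if "?s \<le> I" "0 < pad D s t c I \<and> pad D s t c (I - ?s) = 0"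
  proof -
    have "j \<noteq> 0" using range(1) that(1) by simp
    then obtain j' where j': "j = Suc j'" using not0_implies_Suc by blast
    have I': "I - ?s = j' * ?s + i" using I j' by simp
    have at: "pad D s t c I = (if Suc i < D then 0 else if Suc i = D then padding D t j else c (j * s + (i - D)))"
      "pad D s t c (I - ?s) = (if Suc i < D then 0 else if Suc i = D then padding D t j' else c (j' * s + (i - D)))"
      using pad_at[OF i, of t c] I I' by auto
    have iD: "D \<le> Suc i" using at(1) that by (auto split: if_splits)
    have jt: "j < t"
    proof (rule ccontr)
      assume "\<not> j < t"
      then have "t * s \<le> j * s" by (intro mult_le_mono1) simp
      then have "s * t \<le> j * s + (i - D)" by (simp only: mult.commute[of t] trans_le_add1)
      moreover have "padding D t j = 0" using \<open>\<not> j < t\<close> by (simp add: padding_def)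
      ultimately show False using at(1) that codesD(2)[OF c, of "j * s + (i - D)"] by (auto split: if_splits)
    qed
    have ps: "psum (pad D s t c) (Suc I) = psum c (j * s + (Suc i - D)) + (j + 1) * D"
      using psum_pad[OF D0 jt, of "Suc i" s c] i I iD j' by simp
    have h1: "psupp (pad D s t c) (Suc I) = psupp c (j * s + (Suc i - D)) + j"
      using psupp_pad[OF D0 jt, of "Suc i" s c] i I iD by simp
    have h2: "psupp (pad D s t c) (Suc (I - ?s)) = psupp c (j' * s + (Suc i - D)) + j'"
      using psupp_pad[OF D0, of j' t "Suc i" s c] i I' iD jt j' by simp
    show ?thesis
    proof (cases "Suc i = D")
      case True
      \<comment> \<open>In the padding column the constraint bites in row 1 only: from row 2 on, the
        entry one row up is nonzero too.\<close>
      then have "padding D t j' = 0" using at(2) that by simp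
      then have "j' = 0" using jt j' D0 by (auto simp: padding_def split: if_splits)
      moreover have "psupp c s = 0" "psum c s = 0" using codes_psum_zero[OF c] by auto
      ultimately show ?thesis using ps h1 h2 True j' I by simp
    next
      case False
      then have iD: "D \<le> i" using iD by simp
      define p where "p = j * s + (i - D)"
      have p: "s \<le> p" "p - s = j' * s + (i - D)" by (auto simp: p_def j')
      have "Suc p + psupp c (Suc p) \<le> psum c (Suc p) + s + psupp c (Suc (p - s)) + e"
        using that at iD p by (intro codesD(4)[OF c]) (auto simp: p_def)
      moreover have "j * s + (Suc i - D) = Suc p" "j' * s + (Suc i - D) = Suc (p - s)"
        using iD p by (auto simp: p_def Suc_diff_le)
      moreover have "I = p + (j + 1) * D" using I iD by (simp add: p_def algebra_simps)
      \<comment> \<open>Index and prefix sum both gain \<open>(j + 1) * D\<close>, the width gains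
        \<open>D\<close>, and the two supports gain \<open>j\<close> and \<open>j - 1\<close>. So
        \<open>D\<close> has to pay for \<open>e\<close> and one more, whence
        \<open>e < D\<close>.\<close>
      ultimately show ?thesis using ps h1 h2 D j' by (simp del: psupp_Suc sum.lessThan_Suc)
    qed
  qed
qed

lemma inj_on_pad:
  assumes "0 < s"
  shows "inj_on (pad D s t) C"
proof (rule inj_onI, rule ext)
  fix c d p assume eq: "pad D s t c = pad D s t d"
  have "p mod s + D < s + D" using assms by simp
  from pad_at[OF this, of t _ "p div s"] have "pad D s t b (p div s * (s + D) + (p mod s + D)) = b p" for b
    by simp
  then show "c p = d p" using eq by metis
qed

lemma card_codes_pad:
  assumes "e < D" "0 < s"
  shows "card (codes e s t) \<le> card (codes 0 (s + D) t)"
  using assms by (intro card_inj_on_le[OF inj_on_pad] finite_codes) (auto intro: pad_in_codes)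

section \<open>Bounds on the number of codes\<close>

lemma card_codes_upper: "card (codes 0 s (Suc r)) \<le> ((s * Suc r + s * r) choose (s * Suc r))"
proof -
  define n where "n = s * Suc r"
  define L where "L = {xs :: nat list. length xs = s * r + 1 \<and> sum_list xs = n}"
  \<comment> \<open>Row 0 vanishes, so \<open>s * r\<close> entries carry a sum of at most
    \<open>n\<close>; the appended entry is the slack that makes it exactly
    \<open>n\<close>.\<close>
  define enc where "enc c = map c [s..<n] @ [n - psum c n]" for c
  have "card (codes 0 s (Suc r)) \<le> card L"
  proof (rule card_inj_on_le)
    show "inj_on enc (codes 0 s (Suc r))"
    proof (rule inj_onI, rule ext)
      fix c d p assume cd: "c \<in> codes 0 s (Suc r)" "d \<in> codes 0 s (Suc r)" "enc c = enc d"
      show "c p = d p"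
      proof (cases "s \<le> p \<and> p < n")
        case True
        then show ?thesis using cd(3) by (auto simp: enc_def)
      next
        case False
        then show ?thesis using codesD(1,2)[OF cd(1), of p] codesD(1,2)[OF cd(2), of p]
          by (metis n_def not_le)
      qed
    qed
    show "enc ` codes 0 s (Suc r) \<subseteq> L"
    proof clarify
      fix c assume c: "c \<in> codes 0 s (Suc r)"
      have "psum c n = psum c s + sum c {s..<n}"
        by (simp add: n_def sum.atLeastLessThan_concat lessThan_atLeast0)
      then have "sum_list (map c [s..<n]) = psum c n"
        using codes_psum_zero[OF c] by (simp add: interv_sum_list_conv_sum_set_nat)
      moreover have "psum c n \<le> n" using codes_psum_le[OF c] by (simp add: n_def)
      ultimately show "enc c \<in> L" by (simp add: L_def enc_def n_def)
    qed
    have "finite {xs. set xs \<subseteq> {..n} \<and> length xs = s * r + 1}" by (intro finite_lists_length_eq) simp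
    then show "finite L" by (rule rev_finite_subset) (auto simp: L_def intro: member_le_sum_list)
  qed
  also have "card L = (n + (s * r + 1) - 1) choose n" unfolding L_def by (rule card_length_sum_list)
  finally show ?thesis by (simp add: n_def)
qed

lemma binomial_term_le:
  fixes x y :: real
  assumes "0 \<le> x" "0 \<le> y"
  shows "real ((a + b) choose a) * x ^ a * y ^ b \<le> (x + y) ^ (a + b)"
proof -
  have "real ((a + b) choose a) * x ^ a * y ^ (a + b - a) \<le> (\<Sum>k\<le>a + b. real ((a + b) choose k) * x ^ k * y ^ (a + b - k))"
    using assms by (intro member_le_sum[of a]) auto
  then show ?thesis by (simp add: binomial_ring)
qed

lemma card_codes_le_power:
  "real (card (codes 0 s (Suc r))) \<le>
    (real (2 * r + 1) ^ (2 * r + 1) / (real r ^ r * real (Suc r) ^ Suc r)) ^ s"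
proof -
  let ?N = "real ((s * Suc r + s * r) choose (s * Suc r))"
  \<comment> \<open>Weights in the ratio \<open>r + 1 : r\<close> of the exponents make this the
    largest term of the expansion, so nothing exponential is lost.\<close>
  have "?N * real (Suc r) ^ (s * Suc r) * real r ^ (s * r) \<le> (real (Suc r) + real r) ^ (s * Suc r + s * r)"
    by (rule binomial_term_le) auto
  moreover have "s * Suc r + s * r = (2 * r + 1) * s" by (simp add: algebra_simps)
  moreover have "real (Suc r) + real r = real (2 * r + 1)" by simp
  moreover have "real (Suc r) ^ (s * Suc r) = (real (Suc r) ^ Suc r) ^ s" "real r ^ (s * r) = (real r ^ r) ^ s"
    "real (2 * r + 1) ^ ((2 * r + 1) * s) = (real (2 * r + 1) ^ (2 * r + 1)) ^ s"
    by (simp_all only: power_mult[symmetric] mult.commute)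
  ultimately have *: "?N * ((real r ^ r * real (Suc r) ^ Suc r) ^ s) \<le> (real (2 * r + 1) ^ (2 * r + 1)) ^ s"
    by (simp only: power_mult_distrib mult_ac)
  \<comment> \<open>For \<open>r = 0\<close> this rests on \<open>0 ^ 0 = 1\<close>.\<close>
  have "0 < real r ^ r * real (Suc r) ^ Suc r" by (cases r) auto
  then have "?N \<le> (real (2 * r + 1) ^ (2 * r + 1)) ^ s / (real r ^ r * real (Suc r) ^ Suc r) ^ s"
    using * by (simp add: pos_le_divide_eq del: power_Suc of_nat_Suc of_nat_add of_nat_mult)
  then have "?N \<le> (real (2 * r + 1) ^ (2 * r + 1) / (real r ^ r * real (Suc r) ^ Suc r)) ^ s"
    by (simp only: power_divide)
  moreover have "real (card (codes 0 s (Suc r))) \<le> ?N" using card_codes_upper by (simp only: of_nat_le_iff)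
  ultimately show ?thesis by linarith
qed

text \<open>Entropy lower bound: every block of \<open>m\<close> entries has a prescribed sum and is otherwise
  arbitrary. In row 1 the blocks sum to \<open>2 * m\<close>, which brings the partial sums from 0 up to the
  diagonal; from then on they follow the diagonal.\<close>

definition block_sum :: "nat \<Rightarrow> nat \<Rightarrow> nat \<Rightarrow> nat" where
  "block_sum m k b = (if b < k then 0 else if b < 2 * k - 1 then 2 * m else if b < 2 * k then 0 else m)"

definition blocks :: "nat \<Rightarrow> nat \<Rightarrow> nat \<Rightarrow> nat list set" where
  "blocks m k b = {xs. length xs = m \<and> sum_list xs = block_sum m k b}"

definition block_code :: "nat \<Rightarrow> nat \<Rightarrow> (nat \<Rightarrow> nat list) \<Rightarrow> nat \<Rightarrow> nat" where
  "block_code m n F p = (if p < n * m then F (p div m) ! (p mod m) else 0)"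

text \<open>The last block of row 1 is empty because another \<open>2 * m\<close> would bring the
  sum to \<open>2 * m * k\<close> at index \<open>2 * m * k - 1\<close>, above the upper barrier.
  Afterwards the sums at block ends trail the diagonal by \<open>2 * m\<close>.\<close>

lemma sum_block_sum:
  assumes "0 < k"
  shows "(\<Sum>b<B. block_sum m k b) = (if B \<le> k then 0 else if B < 2 * k then 2 * m * (B - k) else m * (B - 2))"
proof (induction B)
  case (Suc B)
  have "2 * m * (Suc B - k) = 2 * m + 2 * m * (B - k)" if "k \<le> B"
    using that by (simp add: Suc_diff_le)
  moreover have "m * (Suc B - 2) = m + m * (B - 2)" if "2 * k \<le> B"
  proof -
    have "Suc B - 2 = Suc (B - 2)" using that assms by linarith
    then show ?thesis by simp
  qed
  moreover have "2 * m * (B - k) = m * (Suc B - 2)" if "Suc B = 2 * k"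
  proof -
    have "2 * (B - k) = Suc B - 2" using that by simp
    then show ?thesis by (metis mult.assoc mult.commute)
  qed
  ultimately show ?case using Suc assms by (auto simp: block_sum_def)
qed simp

lemma psum_block_code:
  assumes F: "F \<in> Pi\<^sub>E {..<k * t} (blocks m k)" and k: "0 < k" and "B \<le> k * t"
  shows "psum (block_code m (k * t) F) (m * B) = (\<Sum>b<B. block_sum m k b)"
proof -
  have "(\<Sum>l<m. block_code m (k * t) F (m * b + l)) = block_sum m k b" if b: "b < B" for b
  proof -
    have "m * b + l < k * t * m" if "l < m" for l
    proof -
      have "m * b + l < m * Suc b" using that by simp
      also have "\<dots> \<le> m * (k * t)" using b assms by (intro mult_le_mono2) auto
      finally show ?thesis by (simp add: mult.commute)
    qed
    then have "(\<Sum>l<m. block_code m (k * t) F (m * b + l)) = (\<Sum>l<m. F b ! l)"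
      by (intro sum.cong) (auto simp: block_code_def)
    also have "\<dots> = sum_list (F b)"
      using F b assms by (auto simp: PiE_iff blocks_def sum_list_sum_nth lessThan_atLeast0)
    also have "\<dots> = block_sum m k b" using F b assms by (auto simp: PiE_iff blocks_def)
    finally show ?thesis .
  qed
  then show ?thesis by (simp add: psum_blocks)
qed

lemma block_code_in_codes:
  assumes F: "F \<in> Pi\<^sub>E {..<k * t} (blocks m k)" and k: "0 < k" and m: "0 < m" and t: "0 < t"
  shows "block_code m (k * t) F \<in> codes (3 * m) (k * m) t"
  unfolding codes_def
proof (intro CollectI conjI allI impI)
  let ?c = "block_code m (k * t) F"
  note sums = psum_block_code[OF F k, unfolded sum_block_sum[OF k]]
  have "k \<le> k * t" using t by simp
  then have "psum ?c (m * k) = 0" using sums[of k] by simp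
  then have zero: "?c p = 0" if "p < m * k" for p using that by simp
  have supp0: "psupp ?c (m * k) = 0" using zero by (simp add: psupp_def)
  fix p
  define b where "b = p div m"
  have p: "m * b \<le> p" "Suc p \<le> m * Suc b"
    using dividend_less_times_div[OF m, of p] by (auto simp: b_def)
  have range: "p < k * m * t \<longleftrightarrow> b < k * t" "k * m \<le> p \<longleftrightarrow> k \<le> b"
    unfolding b_def using div_less_iff_less_mult[OF m, of p] less_eq_div_iff_mult_less_eq[OF m, of k p]
    by (simp_all add: ac_simps)
  show "?c p = 0" if "p < k * m \<or> k * m * t \<le> p"
    using that zero[of p] by (auto simp: mult.commute block_code_def mult.left_commute)
  show "psum ?c (Suc p) \<le> p" if "p < k * m * t"
  proof -
    have "psum ?c (Suc p) \<le> psum ?c (m * Suc b)" using p by (intro psum_mono)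
    also have "\<dots> \<le> m * b"
    proof -
      have "2 * (Suc b - k) \<le> b" if "Suc b < 2 * k" using that by linarith
      then have "2 * m * (Suc b - k) \<le> m * b" if "Suc b < 2 * k" using that by simp
      then show ?thesis using sums[of "Suc b"] range that by auto
    qed
    finally show ?thesis using p by simp
  qed
  show "Suc p + psupp ?c (Suc p) \<le> psum ?c (Suc p) + k * m + psupp ?c (Suc (p - k * m)) + 3 * m"
    if "k * m \<le> p" "0 < ?c p \<and> ?c (p - k * m) = 0"
  proof -
    have "p < k * m * t" using that(2) by (auto simp: block_code_def mult_ac split: if_splits)
    then have b: "b < k * t" "k \<le> b" using range that by auto
    have "psum ?c (m * b) \<le> psum ?c (Suc p)" using p by (intro psum_mono) auto
    then have low: "(if b \<le> k then 0 else if b < 2 * k then 2 * m * (b - k) else m * (b - 2)) \<le> psum ?c (Suc p)"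
      using sums[of b] b by simp
    \<comment> \<open>In row 1 there are at most \<open>Suc p - k * m\<close> nonzero entries so
      far, which the double speed of the sums matches up to \<open>2 * m\<close>. Later the support
      grows by at most \<open>k * m\<close> within one row; the violation is then
      \<open>2 * m\<close> for the gap to the diagonal plus \<open>m\<close> for rounding
      \<open>p\<close> to a block.\<close>
    show ?thesis
    proof (cases "b < 2 * k")
      case True
      then have "2 * m * (b - k) \<le> psum ?c (Suc p)" using low by (auto split: if_splits)
      moreover have "2 * m * (b - k) + 2 * (k * m) = 2 * (m * b)"
        using b(2) by (metis add_mult_distrib2 le_add_diff_inverse2 mult.assoc mult.commute)
      moreover have "psupp ?c (Suc p) \<le> Suc p - k * m"
        using psupp_le_add[of ?c "m * k" "Suc p - m * k"] that(1) supp0 by (simp add: mult.commute del: psupp_Suc)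
      ultimately show ?thesis using p that(1) by (simp del: psupp_Suc sum.lessThan_Suc)
    next
      case False
      then have "m * (b - 2) \<le> psum ?c (Suc p)" using low k by (auto split: if_splits)
      moreover have "m * (b - 2) + 2 * m = m * b" using False k
        by (metis (no_types) add_mult_distrib2 le_add_diff_inverse2 mult.commute mult_le_mono2 not_less Suc_leI One_nat_def mult.right_neutral order.trans)
      moreover have "psupp ?c (Suc p) \<le> psupp ?c (Suc (p - k * m)) + k * m"
        using psupp_le_add[of ?c "Suc (p - k * m)" "k * m"] that(1) by (simp del: psupp_Suc)
      ultimately show ?thesis using p by (simp del: psupp_Suc sum.lessThan_Suc)
    qed
  qed
qed

lemma inj_on_block_code:
  assumes "0 < m"
  shows "inj_on (block_code m n) (Pi\<^sub>E {..<n} (blocks m k))"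
proof (rule inj_onI)
  fix F G assume FG: "F \<in> Pi\<^sub>E {..<n} (blocks m k)" "G \<in> Pi\<^sub>E {..<n} (blocks m k)"
    and eq: "block_code m n F = block_code m n G"
  show "F = G"
  proof (rule PiE_ext[OF FG])
    fix b assume b: "b \<in> {..<n}"
    show "F b = G b"
    proof (rule nth_equalityI)
      show "length (F b) = length (G b)" using FG b by (auto simp: PiE_iff blocks_def)
      fix i assume "i < length (F b)"
      then have i: "i < m" using FG b by (auto simp: PiE_iff blocks_def)
      have "b * m + i < Suc b * m" using i by simp
      also have "\<dots> \<le> n * m" using b by (intro mult_le_mono1) auto
      finally have "block_code m n F' (b * m + i) = F' b ! i" for F' using i by (simp add: block_code_def)
      then show "F b ! i = G b ! i" using eq by metis
    qed
  qed
qed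

text \<open>The blocks are independent, and one of sum \<open>S\<close> has
  \<open>(S + m - 1) choose S\<close> fillings: row 1 has \<open>k - 1\<close> nontrivial blocks,
  each of the \<open>r\<close> later rows has \<open>k\<close>.\<close>

lemma card_codes_ge:
  assumes "0 < m" "0 < k"
  shows "((3 * m - 1) choose (2 * m)) ^ (k - 1) * ((2 * m - 1) choose m) ^ (k * r)
    \<le> card (codes (3 * m) (k * m) (r + 2))"
proof -
  let ?w = "\<lambda>b. card (blocks m k b)"
  have w: "?w b = (block_sum m k b + m - 1) choose (block_sum m k b)" for b
    unfolding blocks_def by (rule card_length_sum_list)
  have 1: "prod ?w {..<k + d} = ((3 * m - 1) choose (2 * m)) ^ d" if "d \<le> k - 1" for d
    using that
  proof (induction d)
    case (Suc d)
    have "block_sum m k (k + d) = 2 * m" 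
    proof -
      have "\<not> k + d < k" "k + d < 2 * k - 1" using Suc.prems by arith+
      then show ?thesis by (simp add: block_sum_def)
    qed
    then have "?w (k + d) = (3 * m - 1) choose (2 * m)" by (simp add: w)
    then show ?case using Suc by simp
  qed (simp add: w block_sum_def)
  have "2 * k = Suc (k + (k - 1))" using assms by simp
  then have 2: "prod ?w {..<2 * k} = ((3 * m - 1) choose (2 * m)) ^ (k - 1)"
  proof -
    have "\<not> k + (k - 1) < k" "\<not> k + (k - 1) < 2 * k - 1" "k + (k - 1) < 2 * k" using assms by arith+
    then have "block_sum m k (k + (k - 1)) = 0" by (simp only: block_sum_def if_False if_True)
    then have "?w (k + (k - 1)) = 1" by (simp add: w)
    then show ?thesis using 1[OF order_refl] \<open>2 * k = _\<close> by (simp only: prod.lessThan_Suc mult_1_right)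
  qed
  have 3: "prod ?w {..<2 * k + d} = ((3 * m - 1) choose (2 * m)) ^ (k - 1) * ((2 * m - 1) choose m) ^ d" for d
  proof (induction d)
    case (Suc d)
    have "\<not> 2 * k + d < k" "\<not> 2 * k + d < 2 * k - 1" "\<not> 2 * k + d < 2 * k" by arith+
    then have "block_sum m k (2 * k + d) = m" by (simp only: block_sum_def if_False)
    then have "?w (2 * k + d) = (2 * m - 1) choose m" by (simp add: w mult_2)
    then show ?case using Suc by simp
  qed (use 2 in simp)
  have "((3 * m - 1) choose (2 * m)) ^ (k - 1) * ((2 * m - 1) choose m) ^ (k * r) = prod ?w {..<k * (r + 2)}"
  proof -
    have "k * (r + 2) = 2 * k + k * r" by (simp add: algebra_simps)
    then show ?thesis by (simp only: 3)
  qed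
  also have "\<dots> = card (Pi\<^sub>E {..<k * (r + 2)} (blocks m k))" by (simp add: card_PiE)
  also have "\<dots> \<le> card (codes (3 * m) (k * m) (r + 2))"
  proof (rule card_inj_on_le)
    show "inj_on (block_code m (k * (r + 2))) (Pi\<^sub>E {..<k * (r + 2)} (blocks m k))"
      using assms(1) by (rule inj_on_block_code)
    show "block_code m (k * (r + 2)) ` Pi\<^sub>E {..<k * (r + 2)} (blocks m k) \<subseteq> codes (3 * m) (k * m) (r + 2)"
      using block_code_in_codes[OF _ assms(2,1), of _ "r + 2"] by (intro image_subsetI) simp
  qed (rule finite_codes)
  finally show ?thesis .
qed

section \<open>Exponential size of the block counts\<close>

lemma pow_27_4_le_binomial_third:
  assumes "0 < m"
  shows "(27 / 4) ^ m \<le> 9 / 4 * real m * real ((3 * m) choose m)"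
  using assms
\<comment> \<open>The induction shows that \<open>m * ((3 * m) choose m) / (27 / 4) ^ m\<close> does
  not decrease; the factor \<open>9 / 4\<close> makes \<open>m = 1\<close> an equality.\<close>
proof (induction m rule: nat_induct_non_zero)
  case 1
  then show ?case by simp
next
  case (Suc m)
  have "real ((3 * Suc m) choose Suc m) = fact (3 * m + 3) / (fact (Suc m) * fact (2 * m + 2))"
    by (subst binomial_fact) (auto simp: algebra_simps)
  also have "(fact (3 * m + 3) :: real) = (3 * real m + 3) * (3 * real m + 2) * (3 * real m + 1) * fact (3 * m)"
    by (simp add: numeral_3_eq_3 algebra_simps)
  also have "(fact (2 * m + 2) :: real) = (2 * real m + 2) * (2 * real m + 1) * fact (2 * m)"
    by (simp add: algebra_simps)
  also have "(fact (Suc m) :: real) = (real m + 1) * fact m" by simp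
  finally have f: "real ((3 * Suc m) choose Suc m) = (3 * real m + 3) * (3 * real m + 2) * (3 * real m + 1) * fact (3 * m) /
      (((real m + 1) * fact m) * ((2 * real m + 2) * (2 * real m + 1) * fact (2 * m)))" .
  have f: "(real m + 1) * (2 * real m + 2) * (2 * real m + 1) * real ((3 * Suc m) choose Suc m) =
      (3 * real m + 3) * (3 * real m + 2) * (3 * real m + 1) * (fact (3 * m) / (fact m * fact (2 * m)))"
  proof -
    have "p * u * v * X = N * (A / (B * C))" if "X = N * A / ((p * B) * (u * v * C))" "p \<noteq> 0" "u \<noteq> 0" "v \<noteq> 0"
      for X N A B C p u v :: real
      using that by simp
    from this[OF f] show ?thesis by (simp add: add_nonneg_eq_0_iff)
  qed
  have "fact (3 * m) / (fact m * fact (2 * m)) = real ((3 * m) choose m)"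
    by (subst binomial_fact) auto
  note f = f[unfolded this]
  have "2 * (real m + 1) * (2 * real m + 1) * real ((3 * Suc m) choose Suc m) =
      3 * (3 * real m + 2) * (3 * real m + 1) * real ((3 * m) choose m)"
  proof -
    have "(real m + 1) * (2 * (real m + 1) * (2 * real m + 1) * real ((3 * Suc m) choose Suc m)) =
      (real m + 1) * (3 * (3 * real m + 2) * (3 * real m + 1) * real ((3 * m) choose m))"
      using f by (simp add: algebra_simps)
    then show ?thesis by (simp only: mult_cancel_left) (simp add: add_eq_0_iff)
  qed
  moreover have "(27 / 4 * real m * (2 * (2 * real m + 1))) * real ((3 * m) choose m)
      \<le> 3 * (3 * real m + 2) * (3 * real m + 1) * real ((3 * m) choose m)"
    by (intro mult_right_mono) (auto simp: algebra_simps)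
  ultimately have "(27 / 4 * real m * real ((3 * m) choose m)) * (2 * (2 * real m + 1))
      \<le> (real (Suc m) * real ((3 * Suc m) choose Suc m)) * (2 * (2 * real m + 1))"
    by (simp add: algebra_simps)
  then have "27 / 4 * real m * real ((3 * m) choose m) \<le> real (Suc m) * real ((3 * Suc m) choose Suc m)"
    by (rule mult_right_le_imp_le) (simp add: add_pos_nonneg)
  then have "9 / 4 * (27 / 4 * real m * real ((3 * m) choose m)) \<le> 9 / 4 * (real (Suc m) * real ((3 * Suc m) choose Suc m))"
    by (rule mult_left_mono) simp
  moreover have "(27 / 4) ^ Suc m \<le> 27 / 4 * (9 / 4 * real m * real ((3 * m) choose m))"
    using Suc.IH by simp
  ultimately show ?case by (simp only: mult_ac)
qed

text \<open>The block count is a third of \<open>(3 * m) choose m\<close>, which turns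
  \<open>9 / 4\<close> into \<open>27 / 4\<close>.\<close>

lemma pow_27_4_le_binomial:
  assumes "0 < m"
  shows "(27 / 4) ^ m \<le> 27 / 4 * real m * real ((3 * m - 1) choose (2 * m))"
proof -
  have "m * ((3 * m) choose m) = 3 * m * ((3 * m - 1) choose (m - 1))"
    using times_binomial_minus1_eq[OF assms, of "3 * m"] by simp
  moreover have "((3 * m - 1) choose (m - 1)) = ((3 * m - 1) choose (2 * m))"
    using assms by (subst binomial_symmetric) (auto intro: arg_cong2[where f = binomial])
  ultimately have "(3 * m) choose m = 3 * ((3 * m - 1) choose (2 * m))" using assms by simp
  then show ?thesis using pow_27_4_le_binomial_third[OF assms] by simp
qed

text \<open>The block count is half of the central binomial coefficient.\<close>

lemma pow_4_le_binomial:
  assumes "0 < m"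
  shows "4 ^ m \<le> 4 * real m * real ((2 * m - 1) choose m)"
proof -
  have "m * ((2 * m) choose m) = 2 * m * ((2 * m - 1) choose (m - 1))"
    using times_binomial_minus1_eq[OF assms, of "2 * m"] by simp
  moreover have "((2 * m - 1) choose (m - 1)) = ((2 * m - 1) choose m)"
    using assms by (subst binomial_symmetric) (auto intro: arg_cong2[where f = binomial])
  ultimately have "(2 * m) choose m = 2 * ((2 * m - 1) choose m)" using assms by simp
  then show ?thesis using central_binomial_lower_bound[OF assms] assms by (simp add: field_simps)
qed

section \<open>The growth rate\<close>

lemma ln_type_bound: "ln (real (type_bound n m)) = 2 * real (n div m) * ln ((real n + 1) ^ 4 + 1)"
proof -
  have "real (type_bound n m) = ((real n + 1) ^ 4 + 1) ^ (2 * (n div m))"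
    by (simp add: type_bound_def add.commute)
  moreover have "0 < (real n + 1) ^ 4 + 1" by (intro add_nonneg_pos) auto
  ultimately show ?thesis by (simp add: ln_realpow)
qed

text \<open>Fekete's argument with error terms: by \<open>super\<close>, for each \<open>s\<close>,
  all late \<open>x N\<close> are at least \<open>b s\<close> up to a vanishing error, and
  \<open>x s - b s\<close> is at most \<open>u s\<close>, which tends to 0. So \<open>x\<close>
  converges to the supremum of \<open>b\<close>.\<close>

lemma growth_rate_exists:
  fixes A :: "nat \<Rightarrow> nat" and M :: real and t :: nat
  assumes pos: "\<And>N. 0 < A N" and bound: "\<And>N. real (A N) \<le> M ^ N" and t: "0 < t"
    and super: "\<And>s m k N. 0 < s \<Longrightarrow> 0 < m \<Longrightarrow> 0 < k \<Longrightarrow> k * (s + 5 * m) \<le> N \<Longrightarrow>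
        A s ^ k \<le> type_bound (s * t) m ^ k * A N"
  shows "\<exists>l. (\<lambda>N. ln (real (A N)) / real N) \<longlonglongrightarrow> l"
proof -
  define x where "x N = ln (real (A N)) / real N" for N
  \<comment> \<open>Order \<open>sqrt s\<close> makes both losses \<open>o(s)\<close>: the
    \<open>5 * m\<close> extra columns, and the logarithm of the number of types, which is of order
    \<open>(s / m) * ln s\<close>.\<close>
  define m where "m s = nat \<lceil>sqrt (real s)\<rceil>" for s
  define T where "T s = ln (real (type_bound (s * t) (m s)))" for s
  define q where "q s = s + 5 * m s" for s
  \<comment> \<open>The growth per column that \<open>super\<close> guarantees: a copy occupies
    \<open>q s\<close> columns and pays \<open>T s\<close> for its type.\<close>
  define b where "b s = (ln (real (A s)) - T s) / real (q s)" for s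
  have x0: "0 \<le> x N" for N using pos[of N] by (simp add: x_def)
  have M: "0 < M"
    using bound[of 1] pos[of 1] by simp
  have xM: "x N \<le> ln M" if "0 < N" for N
  proof -
    have "ln (real (A N)) \<le> ln (M ^ N)" using bound[of N] pos[of N] M by (simp del: ln_realpow)
    also have "\<dots> = real N * ln M" using M by (simp add: ln_realpow)
    finally show ?thesis using that by (simp add: x_def divide_le_eq mult.commute)
  qed
  have m_pos: "0 < m s" if "0 < s" for s using that by (simp add: m_def)
  have m_ge: "sqrt (real s) \<le> real (m s)" and m_le: "real (m s) \<le> sqrt (real s) + 1" for s
    by (auto simp: m_def of_nat_nat ceiling_le)
  have tb_pos: "0 < type_bound n k" for n k by (simp add: type_bound_def)
  have low: "b s - b s * real (q s) / real N \<le> x N" if s: "0 < s" and N: "q s \<le> N" for s N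
  proof -
    define k where "k = N div q s"
    have q: "0 < q s" using s by (simp add: q_def)
    have k: "0 < k" "k * q s \<le> N" using N q by (auto simp: k_def div_greater_zero_iff)
    have N0: "0 < N" using N q by linarith
    have "real (A s ^ k) \<le> real (type_bound (s * t) (m s) ^ k * A N)"
      using super[OF s m_pos[OF s] k(1)] k(2) by (simp only: of_nat_le_iff q_def)
    then have "ln (real (A s) ^ k) \<le> ln (real (type_bound (s * t) (m s)) ^ k * real (A N))"
      using pos[of s] pos[of N] tb_pos by (subst ln_le_cancel_iff) auto
    then have "real k * ln (real (A s)) \<le> real k * T s + ln (real (A N))"
      using pos[of s] pos[of N] tb_pos by (simp add: ln_mult ln_realpow T_def)
    then have *: "real k * real (q s) * b s \<le> ln (real (A N))"
    proof -
      have "real (q s) * b s = ln (real (A s)) - T s" using q by (simp add: b_def)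
      then have "real k * real (q s) * b s = real k * ln (real (A s)) - real k * T s"
        by (simp only: mult.assoc right_diff_distrib)
      then show ?thesis using \<open>real k * ln (real (A s)) \<le> _\<close> by linarith
    qed
    show ?thesis
    proof (cases "b s \<le> 0")
      \<comment> \<open>The bound is then at most 0, because \<open>q s \<le> N\<close>, while
        \<open>x N\<close> is nonnegative.\<close>
      case True
      have "b s - b s * real (q s) / real N = b s * (1 - real (q s) / real N)" by (simp add: algebra_simps)
      also have "\<dots> \<le> 0" using True N N0 by (intro mult_nonpos_nonneg) auto
      finally show ?thesis using x0[of N] by linarith
    next
      case False
      have "N < k * q s + q s" using q by (simp add: k_def) (metis add.commute dividend_less_div_times)
      then have "real N - real (q s) \<le> real k * real (q s)"
        by (metis less_imp_le of_nat_add of_nat_le_iff of_nat_mult diff_le_eq)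
      then have "(real N - real (q s)) * b s \<le> real k * real (q s) * b s" using False by (intro mult_right_mono) auto
      then have "(real N - real (q s)) * b s \<le> ln (real (A N))" using * by linarith
      then have "(real N - real (q s)) * b s / real N \<le> x N" unfolding x_def by (rule divide_right_mono) simp
      moreover have "(real N - real (q s)) * b s / real N = b s - b s * real (q s) / real N"
        using N0 by (simp add: field_simps)
      ultimately show ?thesis by simp
    qed
  qed
  have low_lim: "(\<lambda>N. b s - b s * real (q s) / real N) \<longlonglongrightarrow> b s" for s
    by real_asymp
  have bM: "b s \<le> ln M" if s: "0 < s" for s
  proof (rule LIMSEQ_le_const2[OF low_lim])
    show "\<exists>N0. \<forall>N\<ge>N0. b s - b s * real (q s) / real N \<le> ln M"
    proof (intro exI allI impI)
      fix N assume "Suc (q s) \<le> N"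
      then show "b s - b s * real (q s) / real N \<le> ln M" using low[OF s, of N] xM[of N] by simp
    qed
  qed
  define u where "u s = ln M * (5 * (sqrt (real s) + 1) / real s) +
    2 * real t / sqrt (real s) * ln ((real s * real t + 1) ^ 4 + 1)" for s
  have xb: "x s - b s \<le> u s" if s: "0 < s" for s
  proof -
    have q: "real s \<le> real (q s)" "0 < real (q s)" using s by (auto simp: q_def)
    have lnM: "0 \<le> ln M" using x0[of s] xM[OF s] by simp
    have T0: "0 \<le> T s" using tb_pos[of "s * t" "m s"] by (simp add: T_def)
    have "x s - b s = x s * (5 * real (m s) / real (q s)) + T s / real (q s)"
    proof -
      have "x s * real (q s) = ln (real (A s)) + x s * (5 * real (m s))"
        using s by (simp add: x_def q_def field_simps)
      then have "(x s - b s) * real (q s) = x s * (5 * real (m s)) + T s"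
      proof -
        have "real (q s) * b s = ln (real (A s)) - T s" using q by (simp add: b_def)
        then show ?thesis using \<open>x s * real (q s) = _\<close>
          unfolding left_diff_distrib by (simp add: mult.commute)
      qed
      then show ?thesis using q by (simp add: field_simps)
    qed
    also have "\<dots> \<le> ln M * (5 * (sqrt (real s) + 1) / real s) + T s / real s"
      using x0 xM[OF s] lnM T0 q s m_le[of s]
      by (intro add_mono mult_mono frac_le) auto
    also have "T s / real s \<le> 2 * real t / sqrt (real s) * ln ((real s * real t + 1) ^ 4 + 1)"
    proof -
      let ?l = "ln ((real s * real t + 1) ^ 4 + 1)"
      have l0: "0 \<le> ?l" by (intro ln_ge_zero) simp
      have "real (s * t div m s) \<le> real (s * t) / real (m s)" by (rule of_nat_div_le_of_nat)
      also have "\<dots> \<le> real (s * t) / sqrt (real s)" using m_ge[of s] s m_pos[OF s]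
        by (intro divide_left_mono) auto
      finally have "2 * real (s * t div m s) * ?l \<le> 2 * (real (s * t) / sqrt (real s)) * ?l"
        using l0 by (intro mult_right_mono) auto
      then have "T s \<le> real s * (2 * real t / sqrt (real s) * ?l)"
        unfolding T_def ln_type_bound by (simp add: mult_ac)
      then show ?thesis using s by (simp add: divide_le_eq mult.commute)
    qed
    finally show ?thesis by (simp add: u_def)
  qed
  have u_lim: "u \<longlonglongrightarrow> 0" using t unfolding u_def by real_asymp
  define L where "L = Sup (b ` {0<..})"
  have bdd: "bdd_above (b ` {0<..})" using bM by (intro bdd_aboveI[of _ "ln M"]) auto
  have bL: "b s \<le> L" if "0 < s" for s unfolding L_def using that bdd by (intro cSup_upper) auto
  have "x \<longlonglongrightarrow> L"
  proof (rule LIMSEQ_I)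
    fix e :: real assume e: "0 < e"
    have "\<exists>s>0. L - e / 2 < b s"
    proof -
      have "L - e / 2 < Sup (b ` {0<..})" using e by (simp add: L_def)
      then show ?thesis using bdd by (subst (asm) less_cSup_iff) (auto simp: greaterThan_def intro: exI[of _ 1])
    qed
    then obtain s where s: "0 < s" "L - e / 2 < b s" by blast
    have "eventually (\<lambda>N. L - e / 2 < b s - b s * real (q s) / real N) sequentially"
      using low_lim[of s] s(2) by (rule order_tendstoD)
    moreover have "eventually (\<lambda>N. u N < e) sequentially" using u_lim e by (rule order_tendstoD)
    ultimately have "eventually (\<lambda>N. norm (x N - L) < e) sequentially"
      using eventually_ge_at_top[of "q s"] eventually_gt_at_top[of 0]
    proof eventually_elim
      case (elim N)
      have "L - e / 2 < x N" using elim low[OF s(1), of N] by linarith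
      moreover have "x N < L + e" using elim xb[of N] bL[of N] by linarith
      ultimately show ?case using e by (simp add: abs_less_iff)
    qed
    then show "\<exists>no. \<forall>n\<ge>no. norm (x n - L) < e" by (simp add: eventually_sequentially)
  qed
  then show ?thesis unfolding x_def by blast
qed

text \<open>All columns beyond \<open>k * s\<close> serve as padding. There are at least
  \<open>5 * k * m\<close> of them, strictly more than the violation \<open>4 * k * m\<close> of the
  interleaving.\<close>

lemma card_codes_super:
  assumes "0 < s" "0 < m" "0 < k" "k * (s + 5 * m) \<le> N"
  shows "card (codes 0 s t) ^ k \<le> type_bound (s * t) m ^ k * card (codes 0 N t)"
proof -
  have N: "k * s + (N - k * s) = N" using assms(4) by (simp add: algebra_simps)
  have "5 * (k * m) \<le> N - k * s" using assms(4) by (simp add: algebra_simps)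
  moreover have "0 < k * m" using assms by simp
  ultimately have "4 * (k * m) < N - k * s" by linarith
  then have "4 * k * m < N - k * s" by (simp only: mult.assoc)
  then have "card (codes (4 * k * m) (k * s) t) \<le> card (codes 0 N t)"
    using card_codes_pad[of "4 * k * m" "N - k * s" "k * s" t] assms N by simp
  then show ?thesis using card_codes_interleave[OF assms(2,3), of s t]
    by (meson mult_le_mono2 order.trans)
qed

lemma zero_in_codes: "(\<lambda>_. 0) \<in> codes e s t"
  by (simp add: codes_def)

lemma card_codes_pos: "0 < card (codes e s t)"
  using zero_in_codes finite_codes card_gt_0_iff by blast

text \<open>As the limit is given, it may be computed along a subsequence: for fixed
  \<open>m\<close> along the widths \<open>N k\<close>. Then
  \<open>m \<rightarrow> \<infinity>\<close> removes the polynomial factors of the binomial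
  estimates.\<close>

lemma growth_rate_lower:
  assumes "(\<lambda>N. ln (real (card (codes 0 N (r + 2)))) / real N) \<longlonglongrightarrow> l"
  shows "ln (27 / 4) + real r * ln 4 \<le> l"
proof -
  have block: "ln (27 / 4) + real r * ln 4 - (ln (27 / 4 * real m) + real r * ln (4 * real m)) / real m \<le> l"
    if m: "0 < m" for m
  proof -
    define \<beta>1 where "\<beta>1 = real ((3 * m - 1) choose (2 * m))"
    define \<beta>2 where "\<beta>2 = real ((2 * m - 1) choose m)"
    have \<beta>_pos: "0 < \<beta>1" "0 < \<beta>2" using m by (auto simp: \<beta>1_def \<beta>2_def)
    \<comment> \<open>Each row has \<open>k\<close> blocks of length \<open>m\<close>, preceded by
      \<open>3 * m + 1\<close> padding columns that pay for the violation
      \<open>3 * m\<close>.\<close>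
    define N where "N k = k * m + (3 * m + 1)" for k
    have ge: "((real k - 1) * ln \<beta>1 + real k * real r * ln \<beta>2) / real (N k)
        \<le> ln (real (card (codes 0 (N k) (r + 2)))) / real (N k)" if k: "0 < k" for k
    proof (rule divide_right_mono)
      have "((3 * m - 1) choose (2 * m)) ^ (k - 1) * ((2 * m - 1) choose m) ^ (k * r)
          \<le> card (codes 0 (N k) (r + 2))"
        using card_codes_ge[OF m k, of r] card_codes_pad[of "3 * m" "3 * m + 1" "k * m" "r + 2"] m k
        by (simp add: N_def)
      then have "real (((3 * m - 1) choose (2 * m)) ^ (k - 1) * ((2 * m - 1) choose m) ^ (k * r))
          \<le> real (card (codes 0 (N k) (r + 2)))" by (simp only: of_nat_le_iff)
      then have "\<beta>1 ^ (k - 1) * \<beta>2 ^ (k * r) \<le> real (card (codes 0 (N k) (r + 2)))"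
        by (simp add: \<beta>1_def \<beta>2_def)
      then have "ln (\<beta>1 ^ (k - 1) * \<beta>2 ^ (k * r)) \<le> ln (real (card (codes 0 (N k) (r + 2))))"
        using \<beta>_pos by (subst ln_le_cancel_iff) (auto simp: card_codes_pos)
      then show "(real k - 1) * ln \<beta>1 + real k * real r * ln \<beta>2 \<le> ln (real (card (codes 0 (N k) (r + 2))))"
        using \<beta>_pos k by (simp add: ln_mult ln_realpow of_nat_diff)
    qed simp
    have "k * 1 \<le> k * m" for k using m by (intro mult_le_mono2) simp
    then have "k \<le> N k" for k unfolding N_def mult_1_right by (rule trans_le_add1)
    then have "filterlim N at_top sequentially"
      by (intro filterlim_at_top_mono[OF filterlim_ident] always_eventually allI)
    from filterlim_compose[OF assms this]
    have 1: "(\<lambda>k. ln (real (card (codes 0 (N k) (r + 2)))) / real (N k)) \<longlonglongrightarrow> l" .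
    have 2: "(\<lambda>k. ((real k - 1) * ln \<beta>1 + real k * real r * ln \<beta>2) / real (N k)) \<longlonglongrightarrow>
        (ln \<beta>1 + real r * ln \<beta>2) / real m"
    proof -
      define M :: real where "M = real m"
      have "0 < M" using m by (simp add: M_def)
      then have "(\<lambda>k. ((real k - 1) * a + real k * b) / (real k * M + (3 * M + 1))) \<longlonglongrightarrow> (a + b) * inverse M" for a b :: real
        by real_asymp
      from this[of "ln \<beta>1" "real r * ln \<beta>2"] show ?thesis by (simp add: N_def M_def divide_inverse ac_simps)
    qed
    have "(ln \<beta>1 + real r * ln \<beta>2) / real m \<le> l"
      by (rule LIMSEQ_le[OF 2 1]) (use ge in \<open>auto intro!: exI[of _ 1]\<close>)
    moreover have "real m * ln (27 / 4) \<le> ln (27 / 4 * real m) + ln \<beta>1"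
    proof -
      have "ln ((27 / 4) ^ m) \<le> ln (27 / 4 * real m * \<beta>1)"
        using pow_27_4_le_binomial[OF m] \<beta>_pos m by (subst ln_le_cancel_iff) (auto simp: \<beta>1_def)
      then show ?thesis using \<beta>_pos m by (simp only: ln_realpow ln_mult) (simp add: ln_mult)
    qed
    moreover have "real m * ln 4 \<le> ln (4 * real m) + ln \<beta>2"
    proof -
      have "ln (4 ^ m) \<le> ln (4 * real m * \<beta>2)"
        using pow_4_le_binomial[OF m] \<beta>_pos m by (subst ln_le_cancel_iff) (auto simp: \<beta>2_def)
      then show ?thesis using \<beta>_pos m by (simp only: ln_realpow ln_mult) (simp add: ln_mult)
    qed
    then have "real r * (real m * ln 4) \<le> real r * (ln (4 * real m) + ln \<beta>2)" by (rule mult_left_mono) simp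
    ultimately show ?thesis using m by (simp add: field_simps)
  qed
  show ?thesis
  proof (rule LIMSEQ_le_const2)
    show "(\<lambda>m. ln (27 / 4) + real r * ln 4 - (ln (27 / 4 * real m) + real r * ln (4 * real m)) / real m)
        \<longlonglongrightarrow> ln (27 / 4) + real r * ln 4"
    proof -
      have 1: "(\<lambda>m. ln (27 / 4 * real m) / real m) \<longlonglongrightarrow> 0" by real_asymp
      have 2: "(\<lambda>m. ln (4 * real m) / real m) \<longlonglongrightarrow> 0" by real_asymp
      have "(\<lambda>m. ln (27 / 4) + real r * ln 4 - (ln (27 / 4 * real m) / real m + real r * (ln (4 * real m) / real m)))
        \<longlonglongrightarrow> ln (27 / 4) + real r * ln 4 - (0 + real r * 0)"
        by (intro tendsto_intros 1 2)
      then show ?thesis by (simp add: add_divide_distrib)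
    qed
    show "\<exists>N. \<forall>m\<ge>N. ln (27 / 4) + real r * ln 4 - (ln (27 / 4 * real m) + real r * ln (4 * real m)) / real m \<le> l"
      using block by (intro exI[of _ 1]) auto
  qed
qed

theorem theorem4:
  fixes t :: nat
  assumes "t \<ge> 2"
  shows "\<exists>L. (\<lambda>s. root s (real (A321_K s t))) \<longlonglongrightarrow> L \<and>
           4 ^ (t - 2) * (3 + 2 * sqrt 2) \<le> L \<and>
           L \<le> real (2 * t - 1) ^ (2 * t - 1) / (real (t - 1) ^ (t - 1) * real t ^ t)"
proof -
  obtain r where r: "t = r + 2" using assms le_Suc_ex by (metis add.commute)
  let ?A = "\<lambda>s. card (codes 0 s t)"
  define M where "M = real (2 * t - 1) ^ (2 * t - 1) / (real (t - 1) ^ (t - 1) * real t ^ t)"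
  have bound: "real (?A N) \<le> M ^ N" for N
    using card_codes_le_power[of N "t - 1"] assms by (simp add: M_def r del: power_Suc of_nat_Suc)
  obtain l where l: "(\<lambda>N. ln (real (?A N)) / real N) \<longlonglongrightarrow> l"
    using growth_rate_exists[of ?A M t] card_codes_pos bound card_codes_super assms by auto
  have root: "root N (real (A321_K N t)) = exp (ln (real (?A N)) / real N)" if "0 < N" for N
    using that assms card_codes_pos[of 0 N t] A321_K_eq_card_codes[of N t]
    by (simp add: root_powr_inverse powr_def divide_inverse mult.commute)
  have "(\<lambda>N. exp (ln (real (?A N)) / real N)) \<longlonglongrightarrow> exp l"
    using l by (rule tendsto_exp)
  then have lim: "(\<lambda>N. root N (real (A321_K N t))) \<longlonglongrightarrow> exp l"
    by (rule Lim_transform_eventually) (auto simp: root intro: eventually_mono[OF eventually_gt_at_top[of 0]])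
  have "4 ^ (t - 2) * (3 + 2 * sqrt 2) \<le> exp l"
  proof -
    \<comment> \<open>The constant is the one for which
      \<open>3 + 2 * (15 / 8) = 27 / 4\<close>.\<close>
    have "sqrt 2 \<le> 15 / 8" by (rule real_le_lsqrt) (auto simp: power2_eq_square)
    then have "4 ^ r * (3 + 2 * sqrt 2) \<le> 4 ^ r * (27 / 4)" by (intro mult_left_mono) auto
    also have "\<dots> = exp (ln (27 / 4) + real r * ln 4)" by (simp add: exp_add exp_of_nat_mult)
    also have "\<dots> \<le> exp l" using growth_rate_lower[of r l] l r by simp
    finally show ?thesis by (simp add: r)
  qed
  moreover have "exp l \<le> M"
  proof (rule LIMSEQ_le_const2[OF lim])
    have "0 \<le> M" by (simp add: M_def)
    have "root N (real (A321_K N t)) \<le> M" if "1 \<le> N" for N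
    proof -
      have "root N (real (A321_K N t)) \<le> root N (M ^ N)"
        using that bound[of N] A321_K_eq_card_codes[of N t] assms by (intro real_root_le_mono) auto
      also have "\<dots> = M" using that \<open>0 \<le> M\<close> by (intro real_root_power_cancel) auto
      finally show ?thesis .
    qed
    then show "\<exists>N0. \<forall>N\<ge>N0. root N (real (A321_K N t)) \<le> M" by blast
  qed
  ultimately show ?thesis using lim unfolding M_def by blast
qed

end
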